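(* Let $\mathcal A$ be any quantum algorithm that uses no measurements (a unitary operator on $\mathcal H$), and let $\chi:\mathbb Z\to\{0,1\}$ be any Boolean function. Let $a$ be the initial success probability of $\mathcal A$, i.e. the probability that measuring $\mathcal A|\mathbf 0\rangle$ produces a good state. Then there exists a quantum algorithm, which is not given the value of $a$, that finds a good solution using an expected number of $\Theta(\sqrt{1/a})$ applications of $\mathcal A$ and its inverse if $a>0$, and otherwise runs forever.
   Context: Setting. $\mathcal H$ is the state space of a joint quantum system whose first subsystem has orthonormal basis states $|i\rangle$ indexed by integers $i$; every pure state is a superposition $\sum_{i\in\mathbb Z}x_i|i\rangle|\Upsilon_i\rangle$ with only finitely many nonzero amplitudes $x_i$. $|\mathbf 0\rangle\in\mathcal H$ is the fixed all-zero initial state. A state $|i\rangle|\cdot\rangle$ is good if $\chi(i)=1$ and bad if $\chi(i)=0$; finding a good solution means producing, by measurement, an outcome whose first component $i$ satisfies $\chi(i)=1$. The success probability is $a=\langle\Psi^a|\Psi^a\rangle$, where $|\Psi^a\rangle$ is the orthogonal projection of $\mathcal A|\mathbf 0\rangle$ onto the span of the good states. The algorithm uses $\mathcal A$ and $\mathcal A^{-1}$ as black boxes (each use counts as one application) and can evaluate $\chi$, in particular apply $|i\rangle|\cdot\rangle\mapsto(-1)^{\chi(i)}|i\rangle|\cdot\rangle$. It may also prepare $|\mathbf 0\rangle$, perform unitary operations independent of $\mathcal A$ (such as $\mathbf I-2|\mathbf 0\rangle\langle\mathbf 0|$), measure, and use classical randomness and control. The algorithm is uniform in $\mathcal A$ and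 $\chi$, and the constants in $\Theta(\cdot)$ are universal (independent of $\mathcal A$, $\chi$ and $a$). *)

theory Defs
  imports "HOL-Probability.Probability" "HOL-Library.Poly_Mapping"
begin

section \<open>Complex inner product spaces\<close>

class complex_inner = ab_group_add +
  fixes scaleC :: "complex \<Rightarrow> 'a \<Rightarrow> 'a" (infixr "*\<^sub>C" 75)
    and cinner :: "'a \<Rightarrow> 'a \<Rightarrow> complex"
  assumes scaleC_add_right: "c *\<^sub>C (x + y) = c *\<^sub>C x + c *\<^sub>C y"
    and scaleC_add_left: "(c + d) *\<^sub>C x = c *\<^sub>C x + d *\<^sub>C x"
    and scaleC_scaleC: "c *\<^sub>C d *\<^sub>C x = (c * d) *\<^sub>C x"
    and scaleC_one: "1 *\<^sub>C x = x"
    and cinner_commute: "cinner x y = cnj (cinner y x)"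
    and cinner_add_right: "cinner x (y + z) = cinner x y + cinner x z"
    and cinner_scaleC_right: "cinner x (c *\<^sub>C y) = c * cinner x y"
    and cinner_ge_zero: "0 \<le> Re (cinner x x)"
    and cinner_eq_zero_iff: "cinner x x = 0 \<longleftrightarrow> x = 0"

global_interpretation cvec: vector_space "scaleC :: complex \<Rightarrow> 'a \<Rightarrow> 'a::complex_inner"
  by unfold_locales (simp_all add: scaleC_add_right scaleC_add_left scaleC_scaleC scaleC_one)

lemma cinner_zero_right [simp]: "cinner x (0 :: 'a::complex_inner) = 0"
  using cinner_add_right[of x 0 0] by simp

lemma cinner_zero_left [simp]: "cinner (0 :: 'a::complex_inner) x = 0"
  using cinner_commute[of 0 x] by simp

lemma cinner_minus_right: "cinner x (- y) = - cinner x (y :: 'a::complex_inner)"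
  using cinner_add_right[of x y "- y"] by (simp add: eq_neg_iff_add_eq_0 add.commute)

lemma cinner_diff_right: "cinner x (y - z) = cinner x y - cinner x (z :: 'a::complex_inner)"
  using cinner_add_right[of x y "- z"] by (simp add: cinner_minus_right)

lemma Im_cinner_same [simp]: "Im (cinner x (x :: 'a::complex_inner)) = 0"
  using arg_cong[OF cinner_commute[of x x], of Im] by simp

text \<open>
  No completeness is assumed, so surjectivity has to be required explicitly; the inverse of a
  unitary map is then its adjoint.
\<close>

definition is_unitary :: "('a::complex_inner \<Rightarrow> 'a) \<Rightarrow> bool" where
  "is_unitary U \<longleftrightarrow> Vector_Spaces.linear scaleC scaleC U \<and> bij U \<and>
     (\<forall>x y. cinner (U x) (U y) = cinner x y)"

definition orth_proj :: "'a::complex_inner set \<Rightarrow> 'a \<Rightarrow> 'a" where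
  "orth_proj S x = (THE y. y \<in> S \<and> (\<forall>s\<in>S. cinner s (x - y) = 0))"


section \<open>The joint state space\<close>

text \<open>
  For a complex inner product space \<open>'k\<close> (the state space of the second subsystem), the joint
  state space is \<open>int \<Rightarrow>\<^sub>0 'k\<close>: a vector with components \<open>v i\<close> stands for
  the finite sum of the \<open>|i>|v i>\<close>.  The amplitude \<open>x i\<close> is absorbed into \<open>v i\<close>.
\<close>

abbreviation lookup :: "('a \<Rightarrow>\<^sub>0 'b::zero) \<Rightarrow> 'a \<Rightarrow> 'b" where
  "lookup \<equiv> Poly_Mapping.lookup"

abbreviation keys :: "('a \<Rightarrow>\<^sub>0 'b::zero) \<Rightarrow> 'a set" where
  "keys \<equiv> Poly_Mapping.keys"

instantiation poly_mapping :: (type, complex_inner) complex_inner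
begin

definition scaleC_poly_mapping :: "complex \<Rightarrow> ('a \<Rightarrow>\<^sub>0 'b) \<Rightarrow> ('a \<Rightarrow>\<^sub>0 'b)" where
  "scaleC_poly_mapping c = Poly_Mapping.map (scaleC c)"

definition cinner_poly_mapping :: "('a \<Rightarrow>\<^sub>0 'b) \<Rightarrow> ('a \<Rightarrow>\<^sub>0 'b) \<Rightarrow> complex" where
  "cinner_poly_mapping x y = (\<Sum>i\<in>keys x. cinner (lookup x i) (lookup y i))"

lemma lookup_scaleC [simp]:
  "lookup (c *\<^sub>C (x :: 'a \<Rightarrow>\<^sub>0 'b)) i = c *\<^sub>C lookup x i"
  unfolding scaleC_poly_mapping_def by (simp add: Poly_Mapping.map.rep_eq when_def)

lemma cinner_poly_mapping_superset:
  assumes "finite I" "keys x \<subseteq> I"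
  shows "cinner (x :: 'a \<Rightarrow>\<^sub>0 'b) y = (\<Sum>i\<in>I. cinner (lookup x i) (lookup y i))"
  unfolding cinner_poly_mapping_def
  by (rule sum.mono_neutral_left) (use assms in \<open>auto simp: in_keys_iff\<close>)

instance
proof
  fix c d :: complex and x y z :: "'a \<Rightarrow>\<^sub>0 'b"
  show "c *\<^sub>C (x + y) = c *\<^sub>C x + c *\<^sub>C y"
    by (rule poly_mapping_eqI) (simp add: lookup_add scaleC_add_right)
  show "(c + d) *\<^sub>C x = c *\<^sub>C x + d *\<^sub>C x"
    by (rule poly_mapping_eqI) (simp add: lookup_add scaleC_add_left)
  show "c *\<^sub>C d *\<^sub>C x = (c * d) *\<^sub>C x"
    by (rule poly_mapping_eqI) (simp add: scaleC_scaleC)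
  show "1 *\<^sub>C x = x"
    by (rule poly_mapping_eqI) (simp add: scaleC_one)
  have "cinner x y = (\<Sum>i\<in>keys x \<union> keys y. cinner (lookup x i) (lookup y i))"
    by (rule cinner_poly_mapping_superset) auto
  also have "\<dots> = cnj (\<Sum>i\<in>keys x \<union> keys y. cinner (lookup y i) (lookup x i))"
    unfolding cnj_sum by (rule sum.cong[OF refl]) (rule cinner_commute)
  also have "(\<Sum>i\<in>keys x \<union> keys y. cinner (lookup y i) (lookup x i)) = cinner y x"
    by (rule cinner_poly_mapping_superset[symmetric]) auto
  finally show "cinner x y = cnj (cinner y x)" .
  show "cinner x (y + z) = cinner x y + cinner x z"
    by (simp add: cinner_poly_mapping_def lookup_add cinner_add_right sum.distrib)
  show "cinner x (c *\<^sub>C y) = c * cinner x y"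
    by (simp add: cinner_poly_mapping_def cinner_scaleC_right sum_distrib_left)
  show "0 \<le> Re (cinner x x)"
    by (simp add: cinner_poly_mapping_def sum_nonneg cinner_ge_zero)
  show "cinner x x = 0 \<longleftrightarrow> x = 0"
  proof
    assume "cinner x x = 0"
    hence "(\<Sum>i\<in>keys x. Re (cinner (lookup x i) (lookup x i))) = 0"
      by (metis Re_sum cinner_poly_mapping_def zero_complex.simps(1))
    hence "\<forall>i\<in>keys x. Re (cinner (lookup x i) (lookup x i)) = 0"
      by (subst (asm) sum_nonneg_eq_0_iff) (auto simp: cinner_ge_zero)
    hence "\<forall>i\<in>keys x. cinner (lookup x i) (lookup x i) = 0"
      by (simp add: complex_eq_iff)
    hence "lookup x i = 0" for i
      by (cases "i \<in> keys x") (auto simp: cinner_eq_zero_iff in_keys_iff)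
    thus "x = 0"
      by (intro poly_mapping_eqI) simp
  qed (simp add: cinner_poly_mapping_def)
qed

end

abbreviation ket :: "int \<Rightarrow> 'k \<Rightarrow> (int \<Rightarrow>\<^sub>0 'k::complex_inner)" where
  "ket i v \<equiv> Poly_Mapping.single i v"

definition good_space :: "(int \<Rightarrow> bool) \<Rightarrow> (int \<Rightarrow>\<^sub>0 'k::complex_inner) set" where
  "good_space chi = cvec.span {ket i v | i v. chi i}"

definition success_prob ::
    "(int \<Rightarrow> bool) \<Rightarrow> (int \<Rightarrow>\<^sub>0 'k::complex_inner) \<Rightarrow> real" where
  "success_prob chi \<psi> =
     (let \<psi>a = orth_proj (good_space chi) \<psi> in Re (cinner \<psi>a \<psi>a))"

definition phase_flip ::
    "(int \<Rightarrow> bool) \<Rightarrow> (int \<Rightarrow>\<^sub>0 'k) \<Rightarrow> (int \<Rightarrow>\<^sub>0 'k::complex_inner)" where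
  "phase_flip chi \<psi> =
     (\<Sum>i\<in>keys \<psi>. (- 1) ^ of_bool (chi i) *\<^sub>C ket i (lookup \<psi> i))"

text \<open>
  Measurement of the first subsystem.  The argument must be a unit vector for the outcome
  weights to sum to 1; this holds for every state a program with unitary gates can reach.
\<close>

definition outcome_pmf :: "(int \<Rightarrow>\<^sub>0 'k::complex_inner) \<Rightarrow> int pmf" where
  "outcome_pmf \<psi> = embed_pmf (\<lambda>i. Re (cinner (lookup \<psi> i) (lookup \<psi> i)))"

definition collapse :: "int \<Rightarrow> (int \<Rightarrow>\<^sub>0 'k) \<Rightarrow> (int \<Rightarrow>\<^sub>0 'k::complex_inner)" where
  "collapse i \<psi> =
     complex_of_real (1 / sqrt (Re (cinner (lookup \<psi> i) (lookup \<psi> i)))) *\<^sub>C ket i (lookup \<psi> i)"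


section \<open>Quantum programs\<close>

text \<open>
  A program is a finite while program over integer variables, together with one quantum register
  holding a joint state (of type \<open>'h\<close>).  Neither the black box \<open>A\<close> nor \<open>chi\<close> occurs in the syntax
  except through the commands that use them, so a program is uniform in both.
  \<open>LastOutcome\<close> is a read-only register that only measurements can write.
\<close>

datatype aexp = Const int | Var nat | LastOutcome
  | Plus aexp aexp | Minus aexp aexp | Times aexp aexp | Div aexp aexp

datatype bexp = Less aexp aexp | Not bexp | And bexp bexp | Chi aexp

datatype 'h com =
    Assign nat aexp
  | UniformBelow nat aexp
  | Seq "'h com" "'h com"
  | If bexp "'h com" "'h com"
  | While bexp "'h com"
  | Prepare
  | ApplyA
  | ApplyAInv
  | ApplyPhase
  | ApplyU "'h \<Rightarrow> 'h"
  | Measure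

primrec unitary_gates :: "'h::complex_inner com \<Rightarrow> bool" where
  "unitary_gates (Assign x e) = True"
| "unitary_gates (UniformBelow x e) = True"
| "unitary_gates (Seq c d) = (unitary_gates c \<and> unitary_gates d)"
| "unitary_gates (If b c d) = (unitary_gates c \<and> unitary_gates d)"
| "unitary_gates (While b c) = unitary_gates c"
| "unitary_gates Prepare = True"
| "unitary_gates ApplyA = True"
| "unitary_gates ApplyAInv = True"
| "unitary_gates ApplyPhase = True"
| "unitary_gates (ApplyU U) = is_unitary U"
| "unitary_gates Measure = True"

text \<open>
  \<open>todo\<close> is the stack of commands still to be executed; \<open>calls\<close> counts the uses of \<open>A\<close> and of its
  inverse and cannot be read by the program.
\<close>

record 'h config =
  todo :: "'h com list"
  vars :: "nat \<Rightarrow> int"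
  last_outcome :: "int option"
  qstate :: 'h
  calls :: nat

primrec aval :: "aexp \<Rightarrow> 'h config \<Rightarrow> int" where
  "aval (Const n) s = n"
| "aval (Var x) s = vars s x"
| "aval LastOutcome s = (case last_outcome s of None \<Rightarrow> 0 | Some i \<Rightarrow> i)"
| "aval (Plus e f) s = aval e s + aval f s"
| "aval (Minus e f) s = aval e s - aval f s"
| "aval (Times e f) s = aval e s * aval f s"
| "aval (Div e f) s = aval e s div aval f s"

primrec bval :: "(int \<Rightarrow> bool) \<Rightarrow> bexp \<Rightarrow> 'h config \<Rightarrow> bool" where
  "bval chi (Less e f) s = (aval e s < aval f s)"
| "bval chi (Not b) s = (\<not> bval chi b s)"
| "bval chi (And b c) s = (bval chi b s \<and> bval chi c s)"
| "bval chi (Chi e) s = chi (aval e s)"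

text \<open>
  In the following, \<open>A\<close> is the black box, \<open>chi\<close> the Boolean function and \<open>z0\<close> the all-zero
  initial state.
\<close>

primrec exec ::
    "((int \<Rightarrow>\<^sub>0 'k) \<Rightarrow> (int \<Rightarrow>\<^sub>0 'k)) \<Rightarrow> (int \<Rightarrow> bool) \<Rightarrow> (int \<Rightarrow>\<^sub>0 'k) \<Rightarrow>
     (int \<Rightarrow>\<^sub>0 'k::complex_inner) com \<Rightarrow> (int \<Rightarrow>\<^sub>0 'k) config \<Rightarrow> (int \<Rightarrow>\<^sub>0 'k) config pmf"
  where
  "exec A chi z0 (Assign x e) s = return_pmf (s\<lparr>vars := (vars s)(x := aval e s)\<rparr>)"
| "exec A chi z0 (UniformBelow x e) s =
     map_pmf (\<lambda>n. s\<lparr>vars := (vars s)(x := n)\<rparr>) (pmf_of_set {0..<max 1 (aval e s)})"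
| "exec A chi z0 (Seq c d) s = return_pmf (s\<lparr>todo := c # d # todo s\<rparr>)"
| "exec A chi z0 (If b c d) s =
     return_pmf (s\<lparr>todo := (if bval chi b s then c else d) # todo s\<rparr>)"
| "exec A chi z0 (While b c) s =
     return_pmf (if bval chi b s then s\<lparr>todo := c # While b c # todo s\<rparr> else s)"
| "exec A chi z0 Prepare s = return_pmf (s\<lparr>qstate := z0\<rparr>)"
| "exec A chi z0 ApplyA s = return_pmf (s\<lparr>qstate := A (qstate s), calls := Suc (calls s)\<rparr>)"
| "exec A chi z0 ApplyAInv s =
     return_pmf (s\<lparr>qstate := inv A (qstate s), calls := Suc (calls s)\<rparr>)"
| "exec A chi z0 ApplyPhase s = return_pmf (s\<lparr>qstate := phase_flip chi (qstate s)\<rparr>)"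
| "exec A chi z0 (ApplyU U) s = return_pmf (s\<lparr>qstate := U (qstate s)\<rparr>)"
| "exec A chi z0 Measure s =
     map_pmf (\<lambda>i. s\<lparr>last_outcome := Some i, qstate := collapse i (qstate s)\<rparr>)
       (outcome_pmf (qstate s))"

definition halted :: "'h config \<Rightarrow> bool" where
  "halted s \<longleftrightarrow> todo s = []"

definition step ::
    "((int \<Rightarrow>\<^sub>0 'k) \<Rightarrow> (int \<Rightarrow>\<^sub>0 'k)) \<Rightarrow> (int \<Rightarrow> bool) \<Rightarrow> (int \<Rightarrow>\<^sub>0 'k) \<Rightarrow>
     (int \<Rightarrow>\<^sub>0 'k::complex_inner) config \<Rightarrow> (int \<Rightarrow>\<^sub>0 'k) config pmf" where
  "step A chi z0 s =
     (case todo s of [] \<Rightarrow> return_pmf s | c # cs \<Rightarrow> exec A chi z0 c (s\<lparr>todo := cs\<rparr>))"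

definition init_config :: "'h \<Rightarrow> 'h com \<Rightarrow> 'h config" where
  "init_config z0 c =
     \<lparr>todo = [c], vars = (\<lambda>_. 0), last_outcome = None, qstate = z0, calls = 0\<rparr>"

primrec run ::
    "((int \<Rightarrow>\<^sub>0 'k) \<Rightarrow> (int \<Rightarrow>\<^sub>0 'k)) \<Rightarrow> (int \<Rightarrow> bool) \<Rightarrow> (int \<Rightarrow>\<^sub>0 'k) \<Rightarrow>
     (int \<Rightarrow>\<^sub>0 'k::complex_inner) com \<Rightarrow> nat \<Rightarrow> (int \<Rightarrow>\<^sub>0 'k) config pmf" where
  "run A chi z0 c 0 = return_pmf (init_config z0 c)"
| "run A chi z0 c (Suc n) = bind_pmf (run A chi z0 c n) (step A chi z0)"

text \<open>
  Halted configurations are absorbing and \<open>calls\<close> never decreases, so each supremum below is the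
  limit for an unbounded number of steps.
\<close>

definition halting_prob ::
    "((int \<Rightarrow>\<^sub>0 'k) \<Rightarrow> (int \<Rightarrow>\<^sub>0 'k)) \<Rightarrow> (int \<Rightarrow> bool) \<Rightarrow> (int \<Rightarrow>\<^sub>0 'k) \<Rightarrow>
     (int \<Rightarrow>\<^sub>0 'k::complex_inner) com \<Rightarrow> real" where
  "halting_prob A chi z0 c = (SUP n. measure_pmf.prob (run A chi z0 c n) {s. halted s})"

definition finds_good_prob ::
    "((int \<Rightarrow>\<^sub>0 'k) \<Rightarrow> (int \<Rightarrow>\<^sub>0 'k)) \<Rightarrow> (int \<Rightarrow> bool) \<Rightarrow> (int \<Rightarrow>\<^sub>0 'k) \<Rightarrow>
     (int \<Rightarrow>\<^sub>0 'k::complex_inner) com \<Rightarrow> real" where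
  "finds_good_prob A chi z0 c =
     (SUP n. measure_pmf.prob (run A chi z0 c n)
        {s. halted s \<and> (\<exists>i. last_outcome s = Some i \<and> chi i)})"

definition expected_calls ::
    "((int \<Rightarrow>\<^sub>0 'k) \<Rightarrow> (int \<Rightarrow>\<^sub>0 'k)) \<Rightarrow> (int \<Rightarrow> bool) \<Rightarrow> (int \<Rightarrow>\<^sub>0 'k) \<Rightarrow>
     (int \<Rightarrow>\<^sub>0 'k::complex_inner) com \<Rightarrow> ennreal" where
  "expected_calls A chi z0 c =
     (SUP n. \<integral>\<^sup>+ s. of_nat (calls s) \<partial>measure_pmf (run A chi z0 c n))"


section \<open>Basic facts\<close>

lemma sum_lookup_ket:
  "(\<Sum>i\<in>keys \<psi>. ket i (lookup \<psi> i)) = (\<psi> :: int \<Rightarrow>\<^sub>0 'k::complex_inner)"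
  by (rule poly_mapping_eqI)
    (auto simp: lookup_sum lookup_single when_def in_keys_iff)

lemma orth_proj_eqI:
  assumes "cvec.subspace S" "y \<in> S" "\<And>s. s \<in> S \<Longrightarrow> cinner s (x - y) = 0"
  shows "orth_proj S x = y"
  unfolding orth_proj_def
proof (rule the_equality)
  fix y' assume y': "y' \<in> S \<and> (\<forall>s\<in>S. cinner s (x - y') = 0)"
  hence mem: "y' - y \<in> S"
    using assms(1,2) by (simp add: cvec.subspace_diff)
  have "cinner (y' - y) (y' - y) = cinner (y' - y) (x - y) - cinner (y' - y) (x - y')"
    by (simp add: cinner_diff_right[symmetric])
  also have "\<dots> = 0"
    using assms(3)[OF mem] y' mem by simp
  finally show "y' = y"
    by (simp add: cinner_eq_zero_iff)
qed (use assms in auto)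

lemma orth_proj_good_space:
  "orth_proj (good_space chi) \<psi> = (\<Sum>i\<in>{i\<in>keys \<psi>. chi i}. ket i (lookup \<psi> i))"
    (is "_ = ?g")
proof (rule orth_proj_eqI)
  show "cvec.subspace (good_space chi)"
    unfolding good_space_def by (rule cvec.subspace_span)
  show "?g \<in> good_space chi"
    unfolding good_space_def by (intro cvec.span_sum cvec.span_base) auto
  have g: "lookup ?g i = (if chi i then lookup \<psi> i else 0)" for i
    by (auto simp: lookup_sum lookup_single when_def in_keys_iff)
  fix s :: "int \<Rightarrow>\<^sub>0 'a" assume "s \<in> good_space chi"
  hence "lookup s i = 0" if "\<not> chi i" for i
    unfolding good_space_def
    by (induction rule: cvec.span_induct_alt)
      (use that in \<open>auto simp: lookup_add lookup_single when_def split: if_splits\<close>)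
  thus "cinner s (\<psi> - ?g) = 0"
    unfolding cinner_poly_mapping_def
    by (intro sum.neutral) (auto simp: lookup_minus g)
qed

lemma pmf_outcome_pmf:
  assumes "cinner \<psi> \<psi> = 1"
  shows "pmf (outcome_pmf \<psi>) i = Re (cinner (lookup \<psi> i) (lookup \<psi> i))"
  unfolding outcome_pmf_def
proof (rule pmf_embed_pmf)
  let ?p = "\<lambda>i. Re (cinner (lookup \<psi> i) (lookup \<psi> i))"
  have "(\<integral>\<^sup>+ i. ennreal (?p i) \<partial>count_space UNIV) = (\<Sum>i\<in>keys \<psi>. ennreal (?p i))"
    by (rule nn_integral_count_space') (auto simp: in_keys_iff)
  also have "\<dots> = ennreal (\<Sum>i\<in>keys \<psi>. ?p i)"
    by (rule sum_ennreal) (rule cinner_ge_zero)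
  also have "(\<Sum>i\<in>keys \<psi>. ?p i) = Re (cinner \<psi> \<psi>)"
    by (simp add: cinner_poly_mapping_def)
  finally show "(\<integral>\<^sup>+ i. ennreal (?p i) \<partial>count_space UNIV) = 1"
    using assms by simp
qed (rule cinner_ge_zero)

end

theory Submission
  imports Defs
begin

text \<open>
  The search proceeds in rounds.  A round draws \<open>j\<close> uniformly from \<open>{0..<m}\<close>, applies \<open>j\<close> Grover
  iterations to \<open>A |0>\<close> and measures; the bound \<open>m\<close> grows by a factor \<open>5/4\<close> from round to round.
  With \<open>a = sin\<^sup>2 \<theta>\<close>, the measurement succeeds with probability \<open>sin\<^sup>2 ((2j+1)\<theta>)\<close>.  Averaged over
  \<open>j\<close> this is at least \<open>1/4\<close> once \<open>m\<close> exceeds a multiple of \<open>1/sqrt a\<close>, so from then on the cost of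
  a round grows by less than the factor \<open>4/3\<close> by which the probability of reaching it shrinks, and
  the expected total is of order \<open>1/sqrt a\<close>.  Conversely \<open>sin\<^sup>2 ((2j+1)\<theta>) \<le> (2j+1) sin \<theta>\<close> bounds the
  success probability of a round by \<open>sqrt a\<close> times its number of calls; summed over all rounds,
  the halting probability is at most \<open>sqrt a\<close> times the expected number of calls.
\<close>

section \<open>Expectations along a Markov chain\<close>

primrec iter_exp :: "('s \<Rightarrow> 's pmf) \<Rightarrow> ('s \<Rightarrow> ennreal) \<Rightarrow> nat \<Rightarrow> 's \<Rightarrow> ennreal" where
  "iter_exp K f 0 s = f s"
| "iter_exp K f (Suc n) s = (\<integral>\<^sup>+ t. iter_exp K f n t \<partial>measure_pmf (K s))"

definition limit_exp :: "('s \<Rightarrow> 's pmf) \<Rightarrow> ('s \<Rightarrow> ennreal) \<Rightarrow> 's \<Rightarrow> ennreal" where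
  "limit_exp K f s = (SUP n. iter_exp K f n s)"

definition increasing_along :: "('s \<Rightarrow> 's pmf) \<Rightarrow> ('s \<Rightarrow> ennreal) \<Rightarrow> bool" where
  "increasing_along K f \<longleftrightarrow> (\<forall>s. \<forall>t\<in>set_pmf (K s). f s \<le> f t)"

definition subharmonic :: "('s \<Rightarrow> 's pmf) \<Rightarrow> ('s \<Rightarrow> ennreal) \<Rightarrow> bool" where
  "subharmonic K h \<longleftrightarrow> (\<forall>s. h s \<le> (\<integral>\<^sup>+ t. h t \<partial>measure_pmf (K s)))"

definition superharmonic :: "('s \<Rightarrow> 's pmf) \<Rightarrow> ('s \<Rightarrow> ennreal) \<Rightarrow> bool" where
  "superharmonic K h \<longleftrightarrow> (\<forall>s. (\<integral>\<^sup>+ t. h t \<partial>measure_pmf (K s)) \<le> h s)"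

lemma iter_exp_le_Suc:
  assumes "increasing_along K f"
  shows "iter_exp K f n s \<le> iter_exp K f (Suc n) s"
proof (induction n arbitrary: s)
  case 0
  have "f s = (\<integral>\<^sup>+ t. f s \<partial>measure_pmf (K s))"
    by simp
  also have "\<dots> \<le> (\<integral>\<^sup>+ t. f t \<partial>measure_pmf (K s))"
    by (rule nn_integral_mono_AE)
      (use assms in \<open>auto simp: AE_measure_pmf_iff increasing_along_def\<close>)
  finally show ?case
    by simp
next
  case (Suc n)
  have "(\<integral>\<^sup>+ t. iter_exp K f n t \<partial>measure_pmf (K s))
      \<le> (\<integral>\<^sup>+ t. iter_exp K f (Suc n) t \<partial>measure_pmf (K s))"
    by (intro nn_integral_mono Suc.IH)
  thus ?case
    by simp
qed

lemma subharmonic_iter_exp: "increasing_along K f \<Longrightarrow> subharmonic K (iter_exp K f n)"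
  using iter_exp_le_Suc[of K f n] by (simp add: subharmonic_def)

text \<open>The iterates increase, so monotone convergence turns the one-step average of their
  supremum into the supremum of the shifted sequence.\<close>

lemma superharmonic_limit_exp:
  assumes "increasing_along K f"
  shows "superharmonic K (limit_exp K f)"
  unfolding superharmonic_def
proof
  fix s
  have inc: "incseq (iter_exp K f)"
    by (intro incseq_SucI le_funI iter_exp_le_Suc assms)
  have "(\<integral>\<^sup>+ t. limit_exp K f t \<partial>measure_pmf (K s))
      = (SUP n. \<integral>\<^sup>+ t. iter_exp K f n t \<partial>measure_pmf (K s))"
    unfolding limit_exp_def
    by (rule nn_integral_monotone_convergence_SUP[OF inc]) simp
  also have "\<dots> = (SUP n. iter_exp K f (Suc n) s)"
    by simp
  also have "\<dots> \<le> limit_exp K f s"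
    unfolding limit_exp_def by (rule SUP_mono) blast
  finally show "(\<integral>\<^sup>+ t. limit_exp K f t \<partial>measure_pmf (K s)) \<le> limit_exp K f s" .
qed

lemma iter_exp_le_limit_exp: "iter_exp K f n s \<le> limit_exp K f s"
  unfolding limit_exp_def by (rule SUP_upper) simp

lemma le_limit_exp: "f s \<le> limit_exp K f s"
  using iter_exp_le_limit_exp[of K f 0 s] by simp

lemma iter_exp_absorbing: "K s = return_pmf s \<Longrightarrow> iter_exp K f n s = f s"
  by (induction n) auto

lemma nn_integral_run:
  "(\<integral>\<^sup>+ s. f s \<partial>measure_pmf (run A chi z0 c n))
    = iter_exp (step A chi z0) f n (init_config z0 c)"
proof -
  \<comment> \<open>\<open>run\<close> appends steps at the end, \<open>iter_exp\<close> unfolds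
    them at the front. Carrying \<open>m\<close> pending steps lets the induction move one step
    across.\<close>
  have "(\<integral>\<^sup>+ s. iter_exp (step A chi z0) f m s \<partial>measure_pmf (run A chi z0 c n))
      = iter_exp (step A chi z0) f (m + n) (init_config z0 c)" for m
  proof (induction n arbitrary: m)
    case (Suc n)
    show ?case
      using Suc.IH[of "Suc m"] by (simp add: nn_integral_bind_pmf)
  qed simp
  from this[of 0] show ?thesis
    by simp
qed

text \<open>
  Big-step execution, stated through its effect on sub- and superharmonic functions: the number
  of steps taken may depend on the random choices made on the way.
\<close>

definition reaches :: "('s \<Rightarrow> 's pmf) \<Rightarrow> 's \<Rightarrow> 's pmf \<Rightarrow> bool" where
  "reaches K s D \<longleftrightarrow>
     (\<forall>h. subharmonic K h \<longrightarrow> h s \<le> (\<integral>\<^sup>+ t. h t \<partial>measure_pmf D)) \<and>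
     (\<forall>h. superharmonic K h \<longrightarrow> (\<integral>\<^sup>+ t. h t \<partial>measure_pmf D) \<le> h s)"

lemma reaches_refl: "reaches K s (return_pmf s)"
  by (simp add: reaches_def)

text \<open>Sequencing rule: the inequalities for the second phase hold at every possible end point
  \<open>f x\<close> of the first, so they survive averaging over \<open>p\<close>.\<close>

lemma reaches_bind:
  assumes "reaches K s (map_pmf f p)" "\<And>x. x \<in> set_pmf p \<Longrightarrow> reaches K (f x) (D x)"
  shows "reaches K s (bind_pmf p D)"
  unfolding reaches_def
proof (intro conjI allI impI)
  fix h assume h: "subharmonic K h"
  have "h s \<le> (\<integral>\<^sup>+ x. h (f x) \<partial>measure_pmf p)"
    using assms(1) h by (auto simp: reaches_def)
  also have "\<dots> \<le> (\<integral>\<^sup>+ x. (\<integral>\<^sup>+ t. h t \<partial>measure_pmf (D x)) \<partial>measure_pmf p)"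
    by (rule nn_integral_mono_AE)
      (use assms(2) h in \<open>auto simp: AE_measure_pmf_iff reaches_def\<close>)
  finally show "h s \<le> (\<integral>\<^sup>+ t. h t \<partial>measure_pmf (bind_pmf p D))"
    by (simp add: nn_integral_bind_pmf)
next
  fix h assume h: "superharmonic K h"
  have "(\<integral>\<^sup>+ x. (\<integral>\<^sup>+ t. h t \<partial>measure_pmf (D x)) \<partial>measure_pmf p)
      \<le> (\<integral>\<^sup>+ x. h (f x) \<partial>measure_pmf p)"
    by (rule nn_integral_mono_AE)
      (use assms(2) h in \<open>auto simp: AE_measure_pmf_iff reaches_def\<close>)
  also have "\<dots> \<le> h s"
    using assms(1) h by (auto simp: reaches_def)
  finally show "(\<integral>\<^sup>+ t. h t \<partial>measure_pmf (bind_pmf p D)) \<le> h s"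
    by (simp add: nn_integral_bind_pmf)
qed

lemma reaches_kernel: "reaches K s (K s)"
  by (simp add: reaches_def subharmonic_def superharmonic_def)

lemma reaches_trans_return:
  assumes "reaches K s (return_pmf t)" "reaches K t D"
  shows "reaches K s D"
  using assms by (auto simp: reaches_def intro: order_trans)

text \<open>Rule for symbolic execution, processing one deterministic command per
  application.\<close>

lemma reaches_step_return:
  assumes "K s = return_pmf t" "reaches K t D"
  shows "reaches K s D"
  using reaches_trans_return[OF _ assms(2)] reaches_kernel[of K s] assms(1) by simp

section \<open>The search program\<close>

lemma cinner_diff_left: "cinner (x - y) w = cinner x w - cinner y (w :: 'a::complex_inner)"
  by (metis cinner_commute cinner_diff_right complex_cnj_diff)

lemma cinner_scaleC_left: "cinner (c *\<^sub>C x) w = cnj c * cinner x (w :: 'a::complex_inner)"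
  by (metis cinner_commute cinner_scaleC_right complex_cnj_mult)

text \<open>The negative of the usual \<open>I - 2|z><z|\<close>; it absorbs the global minus sign
  of the Grover iterate.\<close>

definition reflection :: "'h::complex_inner \<Rightarrow> 'h \<Rightarrow> 'h" where
  "reflection z v = (2 * cinner z v) *\<^sub>C z - v"

text \<open>Variable 1 counts the iterations still to be made.\<close>

definition grover_com :: "'h::complex_inner \<Rightarrow> 'h com" where
  "grover_com z = Seq ApplyPhase (Seq ApplyAInv (Seq (ApplyU (reflection z))
     (Seq ApplyA (Assign 1 (Minus (Var 1) (Const 1))))))"

definition grover_loop :: "'h::complex_inner \<Rightarrow> 'h com" where
  "grover_loop z = While (Less (Const 0) (Var 1)) (grover_com z)"

text \<open>Variable 0 keeps the bound between rounds. It is enlarged before the draw; the added 1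
  makes it positive from the initial value 0 and keeps it growing while the quotient by 4
  vanishes.\<close>

definition round_com :: "'h::complex_inner \<Rightarrow> 'h com" where
  "round_com z = Seq (Assign 0 (Plus (Plus (Var 0) (Div (Var 0) (Const 4))) (Const 1)))
     (Seq (UniformBelow 1 (Var 0)) (Seq Prepare (Seq ApplyA (Seq (grover_loop z) Measure))))"

definition search_loop :: "'h::complex_inner \<Rightarrow> 'h com" where
  "search_loop z = While (Not (Chi LastOutcome)) (round_com z)"

text \<open>
  \<open>LastOutcome\<close> reads 0 before the first measurement, which \<open>chi\<close> may accept; hence the first
  round is executed unconditionally.
\<close>

definition search_alg :: "'h::complex_inner \<Rightarrow> 'h com" where
  "search_alg z = Seq (round_com z) (search_loop z)"

definition next_bound :: "int \<Rightarrow> int" where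
  "next_bound m = m + m div 4 + 1"

text \<open>The common stack of all rounds: unfolding \<open>search_alg\<close> and entering the
  body of \<open>search_loop\<close> both lead to it.\<close>

definition round_config ::
    "'h::complex_inner \<Rightarrow> (nat \<Rightarrow> int) \<Rightarrow> int option \<Rightarrow> 'h \<Rightarrow> nat \<Rightarrow> 'h config" where
  "round_config z vs lo q c =
     \<lparr>todo = [round_com z, search_loop z], vars = vs, last_outcome = lo, qstate = q, calls = c\<rparr>"

definition halt_config :: "(nat \<Rightarrow> int) \<Rightarrow> int option \<Rightarrow> 'h \<Rightarrow> nat \<Rightarrow> 'h config" where
  "halt_config vs lo q c =
     \<lparr>todo = [], vars = vs, last_outcome = lo, qstate = q, calls = c\<rparr>"

definition grover_op ::
    "((int \<Rightarrow>\<^sub>0 'k) \<Rightarrow> (int \<Rightarrow>\<^sub>0 'k)) \<Rightarrow> (int \<Rightarrow> bool) \<Rightarrow> (int \<Rightarrow>\<^sub>0 'k) \<Rightarrow>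
     (int \<Rightarrow>\<^sub>0 'k::complex_inner) \<Rightarrow> (int \<Rightarrow>\<^sub>0 'k)" where
  "grover_op A chi z v = A (reflection z (inv A (phase_flip chi v)))"

definition grover_state ::
    "((int \<Rightarrow>\<^sub>0 'k) \<Rightarrow> (int \<Rightarrow>\<^sub>0 'k)) \<Rightarrow> (int \<Rightarrow> bool) \<Rightarrow> (int \<Rightarrow>\<^sub>0 'k) \<Rightarrow> nat \<Rightarrow>
     (int \<Rightarrow>\<^sub>0 'k::complex_inner)" where
  "grover_state A chi z j = (grover_op A chi z ^^ j) (A z)"

text \<open>The loop test after the measurement is included, so a round ends either halted or at the
  start of the next one. The calls are one for \<open>A |0>\<close> and two for each of the
  \<open>j\<close> iterations.\<close>

definition round_result ::
    "((int \<Rightarrow>\<^sub>0 'k) \<Rightarrow> (int \<Rightarrow>\<^sub>0 'k)) \<Rightarrow> (int \<Rightarrow> bool) \<Rightarrow> (int \<Rightarrow>\<^sub>0 'k) \<Rightarrow>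
     (nat \<Rightarrow> int) \<Rightarrow> nat \<Rightarrow> nat \<Rightarrow> int \<Rightarrow> (int \<Rightarrow>\<^sub>0 'k::complex_inner) config" where
  "round_result A chi z vs c j i =
     (if chi i then halt_config else round_config z)
       (vs(0 := next_bound (vs 0), 1 := 0)) (Some i) (collapse i (grover_state A chi z j))
       (c + 2 * j + 1)"

section \<open>Symbolic execution of one round\<close>

lemma unitary_reflection:
  fixes z :: "'h::complex_inner"
  assumes "cinner z z = 1"
  shows "is_unitary (reflection z)"
proof -
  \<comment> \<open>Being its own inverse makes the map bijective, which preservation of the inner
    product alone would not give in infinite dimension.\<close>
  have invol: "reflection z (reflection z v) = v" for v
    using assms
    by (simp add: reflection_def cinner_diff_right cinner_scaleC_right)
  have "bij (reflection z)"
    by (rule o_bij[of "reflection z"]) (auto simp: fun_eq_iff invol)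
  moreover have "Vector_Spaces.linear scaleC scaleC (reflection z)"
    by unfold_locales
      (simp_all add: reflection_def cinner_add_right cinner_scaleC_right scaleC_add_left
        scaleC_scaleC cvec.scale_right_diff_distrib distrib_left mult_ac)
  moreover have "cinner (reflection z x) (reflection z y) = cinner x y" for x y
    using assms cinner_commute[of z x]
    by (simp add: reflection_def cinner_diff_left cinner_diff_right cinner_scaleC_left
        cinner_scaleC_right algebra_simps)
  ultimately show ?thesis
    unfolding is_unitary_def by blast
qed

lemma unitary_gates_search_alg:
  "cinner z z = 1 \<Longrightarrow> unitary_gates (search_alg z)"
  by (simp add: search_alg_def round_com_def search_loop_def grover_loop_def grover_com_def
      unitary_reflection)

text \<open>Generalised over the \<open>k\<close> iterations already made: each pass moves one
  iteration from the counter to the state.\<close>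

lemma reaches_grover_loop:
  "reaches (step A chi z)
     \<lparr>todo = grover_loop z # cs, vars = vs(1 := int j), last_outcome = lo,
        qstate = grover_state A chi z k, calls = c\<rparr>
     (return_pmf \<lparr>todo = cs, vars = vs(1 := 0), last_outcome = lo,
        qstate = grover_state A chi z (k + j), calls = c + 2 * j\<rparr>)"
proof (induction j arbitrary: k c)
  case 0
  show ?case
    by (rule reaches_step_return, (simp add: step_def grover_loop_def; fail)) (simp add: reaches_refl)
next
  case (Suc j)
  note IH = Suc.IH[of "Suc k" "c + 2"]
  have [simp]: "int (Suc j) - 1 = int j"
    by simp
  show ?case
    \<comment> \<open>Ten steps make one pass: the loop test, four \<open>Seq\<close> and five basic
      commands.\<close>
    apply (rule reaches_step_return, simp add: step_def grover_loop_def)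
    apply (rule reaches_step_return, simp add: step_def grover_com_def)
    apply (rule reaches_step_return, simp add: step_def)
    apply (rule reaches_step_return, simp add: step_def)
    apply (rule reaches_step_return, simp add: step_def)
    apply (rule reaches_step_return, simp add: step_def)
    apply (rule reaches_step_return, simp add: step_def)
    apply (rule reaches_step_return, simp add: step_def)
    apply (rule reaches_step_return, simp add: step_def)
    apply (rule reaches_step_return, simp add: step_def)
    using IH
    by (simp add: grover_loop_def grover_com_def grover_state_def grover_op_def fun_upd_def
        cong: if_cong)
qed

lemma measurement_reaches:
  fixes z :: "int \<Rightarrow>\<^sub>0 'k::complex_inner"
  shows "reaches (step A chi z)
     \<lparr>todo = [Measure, search_loop z], vars = vs(0 := next_bound (vs 0), 1 := 0),
        last_outcome = lo, qstate = grover_state A chi z j, calls = c + 2 * j + 1\<rparr>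
     (map_pmf (round_result A chi z vs c j) (outcome_pmf (grover_state A chi z j)))"
    (is "reaches _ ?s _")
proof -
  have *: "step A chi z ?s = map_pmf
      (\<lambda>i. \<lparr>todo = [search_loop z], vars = vs(0 := next_bound (vs 0), 1 := 0),
         last_outcome = Some i, qstate = collapse i (grover_state A chi z j),
         calls = c + 2 * j + 1\<rparr>)
      (outcome_pmf (grover_state A chi z j))"
    by (simp add: step_def)
  show ?thesis
    unfolding map_pmf_def[of "round_result A chi z vs c j"]
    apply (rule reaches_bind)
     apply (rule subst[OF *, of "reaches (step A chi z) _"])
     apply (rule reaches_kernel)
    apply (rule reaches_step_return[OF _ reaches_refl])
    apply (auto simp: step_def search_loop_def round_result_def halt_config_def round_config_def)
    done
qed

text \<open>The first step is kept apart from the rest of the round so that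
  \<open>round_upper\<close> can trade it for a smaller index.\<close>

lemma round_config_reaches:
  fixes z :: "int \<Rightarrow>\<^sub>0 'k::complex_inner"
  assumes "0 \<le> vs 0" and K: "K = step A chi z"
  shows "\<exists>t. K (round_config z vs lo q c) = return_pmf t \<and>
    reaches K t (bind_pmf (pmf_of_set {..<nat (next_bound (vs 0))})
       (\<lambda>j. map_pmf (round_result A chi z vs c j) (outcome_pmf (grover_state A chi z j))))"
proof -
  define m where "m = nat (next_bound (vs 0))"
  define D where
    "D j = map_pmf (round_result A chi z vs c j) (outcome_pmf (grover_state A chi z j))" for j
  have m: "0 < m" "next_bound (vs 0) = int m"
    using assms by (auto simp: m_def next_bound_def)
  \<comment> \<open>The semantics of \<open>UniformBelow\<close> raises bounds below 1 to 1; the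
    bound here is already positive.\<close>
  have max: "max 1 (int m) = int m"
    using m by simp
  let ?vs = "vs(0 := int m)"
  let ?rest = "Seq Prepare (Seq ApplyA (Seq (grover_loop z) Measure))"
  let ?u = "\<lparr>todo = [UniformBelow 1 (Var 0), ?rest, search_loop z], vars = ?vs,
    last_outcome = lo, qstate = q, calls = c\<rparr>"
  let ?w = "\<lambda>j. \<lparr>todo = [?rest, search_loop z], vars = ?vs(1 := int j),
    last_outcome = lo, qstate = q, calls = c\<rparr>"
  have u: "reaches K ?u (bind_pmf (pmf_of_set {..<m}) D)"
  proof (rule reaches_bind)
    have "inj_on int {..<m}" "{0..<int m} = int ` {..<m}"
      by (auto simp: image_int_atLeastLessThan lessThan_atLeast0)
    hence "pmf_of_set {0..<int m} = map_pmf int (pmf_of_set {..<m})"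
      using m by (metis finite_lessThan lessThan_empty_iff map_pmf_of_set_inj
          less_numeral_extra(3) bot_nat_def)
    hence "K ?u = map_pmf ?w (pmf_of_set {..<m})"
      by (simp add: K step_def max map_pmf_comp)
    thus "reaches K ?u (map_pmf ?w (pmf_of_set {..<m}))"
      using reaches_kernel[of K ?u] by simp
  next
    fix j
    have "A z = grover_state A chi z 0"
      by (simp add: grover_state_def)
    hence loop: "reaches K
        \<lparr>todo = [grover_loop z, Measure, search_loop z], vars = ?vs(1 := int j),
           last_outcome = lo, qstate = A z, calls = Suc c\<rparr> (D j)"
      unfolding K D_def
      by (simp only:)
        (rule reaches_trans_return[OF reaches_grover_loop],
          use measurement_reaches[of A chi z vs lo j c] m(2) in simp)
    show "reaches K (?w j) (D j)"
      apply (rule reaches_step_return, simp add: K step_def)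
      apply (rule reaches_step_return, simp add: K step_def)
      apply (rule reaches_step_return, simp add: K step_def)
      apply (rule reaches_step_return, simp add: K step_def)
      apply (rule reaches_step_return, simp add: K step_def)
      using loop by simp
  qed
  have "reaches K
      \<lparr>todo = [Seq (UniformBelow 1 (Var 0)) ?rest, search_loop z], vars = ?vs,
         last_outcome = lo, qstate = q, calls = c\<rparr> (bind_pmf (pmf_of_set {..<m}) D)"
    by (rule reaches_step_return[OF _ u]) (simp add: K step_def)
  hence v: "reaches K
      \<lparr>todo = [Assign 0 (Plus (Plus (Var 0) (Div (Var 0) (Const 4))) (Const 1)),
           Seq (UniformBelow 1 (Var 0)) ?rest, search_loop z], vars = vs,
         last_outcome = lo, qstate = q, calls = c\<rparr> (bind_pmf (pmf_of_set {..<m}) D)"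
    by (rule reaches_step_return[rotated])
      (use m(2) in \<open>simp add: K step_def next_bound_def\<close>)
  show ?thesis
    unfolding m_def[symmetric] D_def[symmetric]
    by (rule exI, rule conjI[OF _ v]) (simp add: K step_def round_config_def round_com_def)
qed

section \<open>Amplitude amplification\<close>

abbreviation weight :: "(int \<Rightarrow>\<^sub>0 'k::complex_inner) \<Rightarrow> int \<Rightarrow> real" where
  "weight \<psi> i \<equiv> Re (cinner (lookup \<psi> i) (lookup \<psi> i))"

lemma cinner_self_of_real: "cinner x x = complex_of_real (Re (cinner x (x :: 'a::complex_inner)))"
  by (simp add: complex_eq_iff)

lemma lookup_phase_flip:
  "lookup (phase_flip chi v) i = (- 1) ^ of_bool (chi i) *\<^sub>C lookup v i"
proof -
  have "lookup (phase_flip chi v) i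
      = (\<Sum>x\<in>keys v. if x = i then (- 1) ^ of_bool (chi i) *\<^sub>C lookup v i else 0)"
    unfolding phase_flip_def lookup_sum by (rule sum.cong) (auto simp: lookup_single when_def)
  thus ?thesis
    by (auto simp: in_keys_iff)
qed

lemma success_prob_eq:
  "success_prob chi \<psi> = (\<Sum>i\<in>keys \<psi>. if chi i then weight \<psi> i else 0)"
proof -
  define g where "g = orth_proj (good_space chi) \<psi>"
  have g: "lookup g i = (if chi i then lookup \<psi> i else 0)" for i
    unfolding g_def orth_proj_good_space
    by (auto simp: lookup_sum lookup_single when_def in_keys_iff)
  have "cinner g g = (\<Sum>i\<in>keys \<psi>. cinner (lookup g i) (lookup g i))"
    by (rule cinner_poly_mapping_superset) (auto simp: in_keys_iff g split: if_splits)
  thus ?thesis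
    by (auto simp: success_prob_def Let_def g g_def[symmetric] intro!: sum.cong)
qed

text \<open>The weights of a unit vector sum to 1, so the good indices carry
  \<open>success_prob\<close> and the bad ones the rest. Every sum whose coefficient depends only on
  goodness is evaluated this way.\<close>

lemma sum_weight_split:
  assumes "cinner \<psi> \<psi> = 1"
  shows "(\<Sum>i\<in>keys \<psi>. (if chi i then x else y) * weight \<psi> i)
    = x * success_prob chi \<psi> + y * (1 - success_prob chi \<psi>)"
proof -
  have "(\<Sum>i\<in>keys \<psi>. weight \<psi> i) = 1"
    using arg_cong[OF assms, of Re] by (simp add: cinner_poly_mapping_def)
  moreover have "(\<Sum>i\<in>keys \<psi>. weight \<psi> i)
      = success_prob chi \<psi> + (\<Sum>i\<in>keys \<psi>. if chi i then 0 else weight \<psi> i)"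
    unfolding success_prob_eq sum.distrib[symmetric] by (rule sum.cong) auto
  moreover have "(\<Sum>i\<in>keys \<psi>. (if chi i then x else y) * weight \<psi> i)
      = x * success_prob chi \<psi> + y * (\<Sum>i\<in>keys \<psi>. if chi i then 0 else weight \<psi> i)"
    unfolding success_prob_eq sum_distrib_left sum.distrib[symmetric] by (rule sum.cong) auto
  ultimately show ?thesis
    by simp
qed

lemma success_prob_nonneg: "0 \<le> success_prob chi \<psi>"
  unfolding success_prob_eq by (rule sum_nonneg) (simp add: cinner_ge_zero)

lemma success_prob_le_1:
  assumes "cinner \<psi> \<psi> = 1"
  shows "success_prob chi \<psi> \<le> 1"
proof -
  have "0 \<le> (\<Sum>i\<in>keys \<psi>. (if chi i then 0 else 1) * weight \<psi> i)"
    by (rule sum_nonneg) (simp add: cinner_ge_zero)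
  thus ?thesis
    using sum_weight_split[OF assms, of chi 0 1] by simp
qed

text \<open>Conjugating the reflection in \<open>z\<close> by the unitary \<open>A\<close> gives the
  reflection in \<open>A z\<close>, since the adjoint of \<open>A\<close> is its inverse.\<close>

lemma grover_op_eq:
  assumes "is_unitary A"
  shows "grover_op A chi z v
    = (2 * cinner (A z) (phase_flip chi v)) *\<^sub>C A z - phase_flip chi v"
proof -
  interpret Vector_Spaces.linear scaleC scaleC A
    using assms by (simp add: is_unitary_def)
  have inv: "A (inv A w) = w" for w
    using assms by (simp add: is_unitary_def bij_is_surj surj_f_inv_f)
  have "cinner z (inv A w) = cinner (A z) w" for w
    using assms inv[of w] unfolding is_unitary_def by metis
  thus ?thesis
    by (simp add: grover_op_def reflection_def diff scale inv)
qed

text \<open>The iterates stay in the plane spanned by the good and bad parts of \<open>A z\<close>,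
  and each iteration rotates by \<open>2 * t\<close>. Stating the coordinates as products with
  \<open>sin t\<close> and \<open>cos t\<close> avoids dividing by either, which may vanish.\<close>

lemma lookup_grover_state:
  assumes A: "is_unitary A" and z: "cinner z z = 1"
    and t: "(sin t)\<^sup>2 = success_prob chi (A z)"
  obtains \<alpha> \<beta> where "\<alpha> * sin t = sin ((2 * real j + 1) * t)"
    and "\<beta> * cos t = cos ((2 * real j + 1) * t)"
    and "\<And>i. lookup (grover_state A chi z j) i
      = complex_of_real (if chi i then \<alpha> else \<beta>) *\<^sub>C lookup (A z) i"
proof -
  define \<psi> where "\<psi> = A z"
  define a where "a = success_prob chi \<psi>"
  have \<psi>: "cinner \<psi> \<psi> = 1"
    using A z by (simp add: is_unitary_def \<psi>_def)
  have sin2: "sin t * sin t = a" and cos2: "cos t * cos t = 1 - a"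
    using t cos_squared_eq[of t] by (simp_all add: a_def \<psi>_def power2_eq_square)
  have double: "sin (2 * t) = 2 * sin t * cos t" "cos (2 * t) = 1 - 2 * a"
    using sin_double[of t] cos_double_sin[of t] sin2 by (simp_all add: power2_eq_square)
  have "\<exists>\<alpha> \<beta>. \<alpha> * sin t = sin ((2 * real j + 1) * t) \<and>
      \<beta> * cos t = cos ((2 * real j + 1) * t) \<and>
      (\<forall>i. lookup (grover_state A chi z j) i
        = complex_of_real (if chi i then \<alpha> else \<beta>) *\<^sub>C lookup \<psi> i)"
  proof (induction j)
    case 0
    show ?case
      by (intro exI[of _ 1]) (simp add: grover_state_def \<psi>_def scaleC_one)
  next
    case (Suc j)
    then obtain \<alpha> \<beta> where
      \<alpha>: "\<alpha> * sin t = sin ((2 * real j + 1) * t)" and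
      \<beta>: "\<beta> * cos t = cos ((2 * real j + 1) * t)" and
      v: "\<And>i. lookup (grover_state A chi z j) i
        = complex_of_real (if chi i then \<alpha> else \<beta>) *\<^sub>C lookup \<psi> i"
      by blast
    define v where "v = grover_state A chi z j"
    \<comment> \<open>The overlap of \<open>A z\<close> with the state after the phase flip; it is
      real.\<close>
    define k where "k = - \<alpha> * a + \<beta> * (1 - a)"
    have flip: "lookup (phase_flip chi v) i
        = complex_of_real (if chi i then - \<alpha> else \<beta>) *\<^sub>C lookup \<psi> i" for i
      using v[of i] by (simp add: lookup_phase_flip v_def scaleC_scaleC scaleC_one)
    have "cinner \<psi> (phase_flip chi v)
        = (\<Sum>i\<in>keys \<psi>. complex_of_real ((if chi i then - \<alpha> else \<beta>) * weight \<psi> i))"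
      unfolding cinner_poly_mapping_def flip cinner_scaleC_right of_real_mult
      by (simp only: cinner_self_of_real[symmetric])
    also have "\<dots> = complex_of_real k"
      unfolding of_real_sum[symmetric] sum_weight_split[OF \<psi>] k_def a_def ..
    finally have "grover_state A chi z (Suc j)
        = complex_of_real (2 * k) *\<^sub>C \<psi> - phase_flip chi v"
      using grover_op_eq[OF A, of chi z v] by (simp add: grover_state_def v_def \<psi>_def)
    hence "lookup (grover_state A chi z (Suc j)) i
        = complex_of_real (if chi i then 2 * k + \<alpha> else 2 * k - \<beta>) *\<^sub>C lookup \<psi> i" for i
      by (simp add: lookup_minus flip cvec.scale_left_diff_distrib[symmetric]
          scaleC_add_left[symmetric])
    \<comment> \<open>With \<open>a\<close> and \<open>1 - a\<close> read as squares of
      \<open>sin t\<close> and \<open>cos t\<close>, the updates of \<alpha> and \<beta> become the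
      addition theorems for the angle \<open>2 * t\<close>.\<close>
    moreover have arg: "(2 * real (Suc j) + 1) * t = (2 * real j + 1) * t + 2 * t"
      by (simp add: algebra_simps)
    have "(2 * k + \<alpha>) * sin t = \<alpha> * sin t * (1 - 2 * a) + \<beta> * (2 * sin t) * (1 - a)"
      by (simp add: k_def algebra_simps)
    hence "(2 * k + \<alpha>) * sin t = \<alpha> * sin t * (1 - 2 * a) + \<beta> * cos t * (2 * sin t * cos t)"
      unfolding cos2[symmetric] by simp
    hence "(2 * k + \<alpha>) * sin t = sin ((2 * real (Suc j) + 1) * t)"
      unfolding arg sin_add double \<alpha> \<beta> by simp
    moreover have "(2 * k - \<beta>) * cos t
        = \<beta> * cos t * (1 - 2 * a) - \<alpha> * sin t * (2 * sin t * cos t)"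
    proof -
      have "(2 * k - \<beta>) * cos t = \<beta> * cos t * (1 - 2 * a) - \<alpha> * (2 * cos t) * a"
        by (simp add: k_def algebra_simps)
      thus ?thesis
        unfolding sin2[symmetric] by simp
    qed
    hence "(2 * k - \<beta>) * cos t = cos ((2 * real (Suc j) + 1) * t)"
      unfolding arg cos_add double \<alpha> \<beta> by simp
    ultimately show ?case
      by blast
  qed
  thus ?thesis
    using that unfolding \<psi>_def by blast
qed

lemma prob_good_grover_state:
  assumes A: "is_unitary A" and z: "cinner z z = 1"
    and t: "(sin t)\<^sup>2 = success_prob chi (A z)"
  shows "measure_pmf.prob (outcome_pmf (grover_state A chi z j)) {i. chi i}
    = (sin ((2 * real j + 1) * t))\<^sup>2"
proof -
  define \<psi> where "\<psi> = A z"
  define v where "v = grover_state A chi z j"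
  define a where "a = success_prob chi \<psi>"
  have \<psi>: "cinner \<psi> \<psi> = 1"
    using A z by (simp add: is_unitary_def \<psi>_def)
  have a: "(sin t)\<^sup>2 = a" "(cos t)\<^sup>2 = 1 - a"
    using t by (simp_all add: cos_squared_eq a_def \<psi>_def)
  obtain \<alpha> \<beta> where
    \<alpha>: "\<alpha> * sin t = sin ((2 * real j + 1) * t)" and
    \<beta>: "\<beta> * cos t = cos ((2 * real j + 1) * t)" and
    v: "\<And>i. lookup v i = complex_of_real (if chi i then \<alpha> else \<beta>) *\<^sub>C lookup \<psi> i"
    using lookup_grover_state[OF A z t] unfolding v_def \<psi>_def by blast
  have v_sq: "cinner (lookup v i) (lookup v i)
      = complex_of_real ((if chi i then \<alpha>\<^sup>2 else \<beta>\<^sup>2) * weight \<psi> i)" for i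
    unfolding v cinner_scaleC_left cinner_scaleC_right
    by (subst cinner_self_of_real[of "lookup \<psi> i"]) (simp add: power2_eq_square)
  have keys: "keys v \<subseteq> keys \<psi>"
    by (auto simp: in_keys_iff v)
  \<comment> \<open>\<open>pmf_outcome_pmf\<close> describes measurements of unit vectors only;
    normalisation comes down to sin^2 + cos^2 = 1.\<close>
  have "cinner v v = (\<Sum>i\<in>keys \<psi>. complex_of_real ((if chi i then \<alpha>\<^sup>2 else \<beta>\<^sup>2) * weight \<psi> i))"
    by (subst cinner_poly_mapping_superset[OF _ keys]) (simp_all only: v_sq finite_keys)
  also have "\<dots> = complex_of_real (\<alpha>\<^sup>2 * a + \<beta>\<^sup>2 * (1 - a))"
    unfolding of_real_sum[symmetric] sum_weight_split[OF \<psi>] a_def ..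
  also have "\<alpha>\<^sup>2 * a + \<beta>\<^sup>2 * (1 - a) = (\<alpha> * sin t)\<^sup>2 + (\<beta> * cos t)\<^sup>2"
    by (simp add: power_mult_distrib a)
  also have "\<dots> = 1"
    unfolding \<alpha> \<beta> by simp
  finally have vv: "cinner v v = 1"
    by simp
  have pmf: "pmf (outcome_pmf v) i = (if chi i then \<alpha>\<^sup>2 else \<beta>\<^sup>2) * weight \<psi> i" for i
    unfolding pmf_outcome_pmf[OF vv] v_sq by simp
  \<comment> \<open>There may be infinitely many good indices; cutting down to \<open>keys\<close>
    makes the probability a finite sum.\<close>
  have "set_pmf (outcome_pmf v) \<subseteq> keys \<psi>"
    by (auto simp: set_pmf_eq pmf in_keys_iff)
  hence "{i. chi i} \<inter> set_pmf (outcome_pmf v)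
      = ({i. chi i} \<inter> keys \<psi>) \<inter> set_pmf (outcome_pmf v)"
    by blast
  hence "measure_pmf.prob (outcome_pmf v) {i. chi i}
      = measure_pmf.prob (outcome_pmf v) (({i. chi i} \<inter> keys \<psi>) \<inter> set_pmf (outcome_pmf v))"
    by (simp only: measure_Int_set_pmf[symmetric, of "outcome_pmf v" "{i. chi i}"])
  also have "\<dots> = measure_pmf.prob (outcome_pmf v) ({i. chi i} \<inter> keys \<psi>)"
    by (rule measure_Int_set_pmf)
  also have "\<dots> = (\<Sum>i\<in>{i. chi i} \<inter> keys \<psi>. \<alpha>\<^sup>2 * weight \<psi> i)"
    by (subst measure_measure_pmf_finite) (auto simp: pmf intro!: sum.cong)
  also have "\<dots> = (\<Sum>i\<in>keys \<psi>. (if chi i then \<alpha>\<^sup>2 else 0) * weight \<psi> i)"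
    by (rule sum.mono_neutral_cong_left) auto
  also have "\<dots> = (\<alpha> * sin t)\<^sup>2"
    unfolding sum_weight_split[OF \<psi>] by (simp add: a a_def[symmetric] power_mult_distrib)
  finally show ?thesis
    unfolding \<alpha> v_def .
qed

section \<open>Averaging over the number of iterations\<close>

text \<open>Induction over all multiples by the addition theorem, bounding each cosine by 1.\<close>

lemma abs_sin_odd_multiple_le: "\<bar>sin ((2 * real j + 1) * t)\<bar> \<le> (2 * real j + 1) * \<bar>sin t\<bar>"
proof -
  have "\<bar>sin (real n * t)\<bar> \<le> real n * \<bar>sin t\<bar>" for n
  proof (induction n)
    case (Suc n)
    have "\<bar>sin (real (Suc n) * t)\<bar> = \<bar>sin (real n * t) * cos t + cos (real n * t) * sin t\<bar>"
      by (simp add: sin_add algebra_simps)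
    also have "\<dots> \<le> \<bar>sin (real n * t)\<bar> * \<bar>cos t\<bar> + \<bar>cos (real n * t)\<bar> * \<bar>sin t\<bar>"
      by (simp add: abs_mult[symmetric] abs_triangle_ineq)
    also have "\<dots> \<le> \<bar>sin (real n * t)\<bar> * 1 + 1 * \<bar>sin t\<bar>"
      by (intro add_mono mult_mono) auto
    also have "\<dots> \<le> real (Suc n) * \<bar>sin t\<bar>"
      using Suc by (simp add: algebra_simps)
    finally show ?case .
  qed simp
  from this[of "2 * j + 1"] show ?thesis
    by (simp add: add.commute)
qed

text \<open>Telescoping: write sin^2 as \<open>(1 - cos x) / 2\<close> and use that
  \<open>2 * sin (2 * t) * cos x\<close> is the difference of \<open>sin (x + 2 * t)\<close> and
  \<open>sin (x - 2 * t)\<close>.\<close>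

lemma sum_sin_squared_odd:
  "4 * sin (2 * t) * (\<Sum>j<m. (sin ((2 * real j + 1) * t))\<^sup>2)
     = 2 * real m * sin (2 * t) - sin (4 * real m * t)"
proof (induction m)
  case (Suc m)
  let ?x = "(4 * real m + 2) * t" and ?s = "sin (2 * t)"
  have "cos ?x = 1 - 2 * (sin ((2 * real m + 1) * t))\<^sup>2"
    using cos_double_sin[of "(2 * real m + 1) * t"] by (simp add: algebra_simps)
  moreover have "sin (4 * real (Suc m) * t) = sin (?x + 2 * t)"
    by (simp add: algebra_simps)
  moreover have "sin (4 * real m * t) = sin (?x - 2 * t)"
    by (simp add: algebra_simps)
  moreover have "sin (?x + 2 * t) = sin (?x - 2 * t) + 2 * ?s * cos ?x"
    unfolding sin_add sin_diff by simp
  ultimately have "sin (4 * real (Suc m) * t)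
      = sin (4 * real m * t) + 2 * ?s * (1 - 2 * (sin ((2 * real m + 1) * t))\<^sup>2)"
    by simp
  moreover have "4 * ?s * (\<Sum>j<Suc m. (sin ((2 * real j + 1) * t))\<^sup>2)
      = 2 * real m * ?s - sin (4 * real m * t) + 4 * ?s * (sin ((2 * real m + 1) * t))\<^sup>2"
    unfolding sum.lessThan_Suc distrib_left Suc ..
  ultimately show ?case
    by (simp only: of_nat_Suc distrib_left distrib_right left_diff_distrib right_diff_distrib)
qed simp

text \<open>The difference vanishes at 0 and has derivative \<open>y * sin y\<close>, which is
  nonnegative up to pi.\<close>

lemma mult_cos_le_sin:
  fixes x :: real
  assumes "0 \<le> x" "x \<le> pi"
  shows "x * cos x \<le> sin x"
proof -
  have "sin 0 - 0 * cos 0 \<le> sin x - x * cos x"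
  proof (rule DERIV_nonneg_imp_nondecreasing[OF assms(1)])
    fix y assume y: "0 \<le> y" "y \<le> x"
    have "((\<lambda>y. sin y - y * cos y) has_real_derivative y * sin y) (at y)"
      by (auto intro!: derivative_eq_intros)
    moreover have "0 \<le> y * sin y"
      using y assms by (simp add: sin_ge_zero)
    ultimately show "\<exists>d. ((\<lambda>y. sin y - y * cos y) has_real_derivative d) (at y) \<and> 0 \<le> d"
      by blast
  qed
  thus ?thesis
    by simp
qed

text \<open>
  The average is \<open>1/2 - sin (4 m t) / (4 m sin (2 t))\<close>.  The quotient is harmless when \<open>m\<close> is
  large compared to \<open>1 / sin (2 t)\<close>; otherwise \<open>t\<close> is so close to \<open>pi/2\<close> that \<open>sin (4 m t) \<le> 0\<close>.
  The constant \<open>3/2\<close> is what makes the second case go through.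
\<close>

lemma quarter_le_mean_sin_squared:
  assumes t: "0 < t" "t \<le> pi / 2" and m: "3 / 2 \<le> real m * sin t"
  shows "real m / 4 \<le> (\<Sum>j<m. (sin ((2 * real j + 1) * t))\<^sup>2)"
proof (cases "t = pi / 2")
  case True
  \<comment> \<open>Here \<open>sin (2 * t)\<close> vanishes and the closed form gives nothing, but
    every term of the sum is 1.\<close>
  have *: "(2 * real j + 1) * (pi / 2) = real j * pi + pi / 2" for j
    by (simp add: field_simps)
  have "sin ((2 * real j + 1) * (pi / 2)) = cos (real j * pi)" for j
    unfolding * sin_add by simp
  hence "(sin ((2 * real j + 1) * t))\<^sup>2 = 1" for j
    unfolding True by (simp add: power2_eq_square flip: power_mult_distrib)
  thus ?thesis
    by simp
next
  case False
  hence pos: "0 < sin t" "0 < cos t" "0 < sin (2 * t)"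
    using t by (auto intro!: sin_gt_zero cos_gt_zero)
  have "sin (4 * real m * t) \<le> real m * sin (2 * t)"
  proof (cases "1 \<le> real m * sin (2 * t)")
    case True
    thus ?thesis
      using sin_le_one order_trans by blast
  next
    case small: False
    \<comment> \<open>Modulo full turns \<open>4 * m * t\<close> is \<open>- 2 * m * x\<close>, so
      it suffices that \<open>2 * m * x\<close> lies between 0 and pi.\<close>
    define x where "x = pi - 2 * t"
    have x: "0 < x" "x < pi" "sin x = sin (2 * t)" "cos x = - cos (2 * t)"
      using t False by (auto simp: x_def sin_diff cos_diff)
    \<comment> \<open>\<open>m * sin (2 * t) < 1\<close> gives
      \<open>m * sin t * cos t < 1/2\<close>, so the hypothesis on \<open>m\<close> yields
      \<open>cos t < 1/3\<close> and thus \<open>cos x = 1 - 2 * (cos t)^2\<close> is at least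
      7/9.\<close>
    have "3 / 2 * cos t \<le> real m * sin t * cos t"
      using m pos by (simp add: mult_right_mono)
    also have "\<dots> < 1 / 2"
      using small by (simp add: sin_double)
    finally have c: "cos t < 1 / 3"
      by simp
    have "(cos t)\<^sup>2 \<le> (1 / 3)\<^sup>2"
      using c pos by (intro power_mono) auto
    hence "7 / 9 \<le> cos x"
      using x(4) cos_double_cos[of t] by (simp add: power2_eq_square)
    hence "x * (7 / 9) \<le> sin x"
      using mult_cos_le_sin[of x] x mult_left_mono[of "7 / 9" "cos x" x] by linarith
    hence "real m * (x * (7 / 9)) \<le> real m * sin x"
      by (intro mult_left_mono) auto
    \<comment> \<open>Since \<open>m * sin x < 1\<close>, the left side is below 18/7, which is less
      than 3.\<close>
    hence "2 * real m * x \<le> pi"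
      using small x pi_gt3 by simp
    hence "0 \<le> sin (2 * real m * x)"
      using x by (intro sin_ge_zero) auto
    moreover have "4 * real m * t = real (2 * m) * pi - 2 * real m * x"
      by (simp add: x_def algebra_simps)
    hence "sin (4 * real m * t) = sin (real (2 * m) * pi - 2 * real m * x)"
      by (rule arg_cong)
    moreover have "\<dots> = - sin (2 * real m * x)"
      unfolding sin_diff cos_npi sin_npi by simp
    ultimately show ?thesis
      using pos by (smt (verit) mult_nonneg_nonneg of_nat_0_le_iff)
  qed
  hence "real m * sin (2 * t) \<le> 4 * sin (2 * t) * (\<Sum>j<m. (sin ((2 * real j + 1) * t))\<^sup>2)"
    unfolding sum_sin_squared_odd by simp
  hence "real m \<le> 4 * (\<Sum>j<m. (sin ((2 * real j + 1) * t))\<^sup>2)"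
    using pos by (simp add: mult.commute mult.left_commute)
  thus ?thesis
    by simp
qed

lemma sum_odd_numbers: "(\<Sum>j<m. 2 * real j + 1) = (real m)\<^sup>2"
  by (induction m) (auto simp: power2_eq_square algebra_simps)

lemma nn_integral_lessThan:
  assumes "0 < m" "\<And>j. j < m \<Longrightarrow> 0 \<le> g j"
  shows "(\<integral>\<^sup>+ j. ennreal (g j) \<partial>measure_pmf (pmf_of_set {..<m}))
    = ennreal ((\<Sum>j<m. g j) / real m)"
proof -
  have "(\<integral>\<^sup>+ j. ennreal (g j) \<partial>measure_pmf (pmf_of_set {..<m}))
      = (\<Sum>j<m. ennreal (g j)) / ennreal (real m)"
    using assms(1) by (subst nn_integral_pmf_of_set) (auto simp: ennreal_of_nat_eq_real_of_nat)
  also have "(\<Sum>j<m. ennreal (g j)) = ennreal (\<Sum>j<m. g j)"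
    by (rule sum_ennreal) (use assms(2) in auto)
  also have "\<dots> / ennreal (real m) = ennreal ((\<Sum>j<m. g j) / real m)"
    using assms by (intro divide_ennreal sum_nonneg) auto
  finally show ?thesis .
qed

lemma nn_integral_pmf_if:
  assumes "0 \<le> x" "0 \<le> y"
  shows "(\<integral>\<^sup>+ i. (if P i then ennreal x else ennreal y) \<partial>measure_pmf p)
    = ennreal (measure_pmf.prob p {i. P i} * x + (1 - measure_pmf.prob p {i. P i}) * y)"
proof -
  have "(\<integral>\<^sup>+ i. (if P i then ennreal x else ennreal y) \<partial>measure_pmf p)
      = (\<integral>\<^sup>+ i. ennreal x * indicator {i. P i} i + ennreal y * indicator (- {i. P i}) i
          \<partial>measure_pmf p)"
    by (rule nn_integral_cong) auto
  also have "\<dots> = ennreal x * emeasure (measure_pmf p) {i. P i}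
      + ennreal y * emeasure (measure_pmf p) (- {i. P i})"
    by (subst nn_integral_add) (auto simp: nn_integral_cmult)
  also have "measure_pmf.prob p (- {i. P i}) = 1 - measure_pmf.prob p {i. P i}"
    by (subst measure_pmf.prob_compl[symmetric]) (auto simp: Compl_eq_Diff_UNIV)
  hence "ennreal x * emeasure (measure_pmf p) {i. P i}
      + ennreal y * emeasure (measure_pmf p) (- {i. P i})
    = ennreal (measure_pmf.prob p {i. P i} * x + (1 - measure_pmf.prob p {i. P i}) * y)"
    using assms
    by (simp add: measure_pmf.emeasure_eq_measure ennreal_mult[symmetric] ennreal_plus[symmetric]
        mult.commute del: ennreal_plus)
  finally show ?thesis .
qed

section \<open>Analysis of the search\<close>

lemma increasing_along_calls: "increasing_along (step A chi z) (\<lambda>s. of_nat (calls s))"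
  unfolding increasing_along_def
proof (intro allI ballI)
  fix s s' assume s': "s' \<in> set_pmf (step A chi z s)"
  have "calls s \<le> calls s'"
  proof (cases "todo s")
    case (Cons c cs)
    thus ?thesis
      using s' by (cases c) (auto simp: step_def)
  qed (use s' in \<open>simp add: step_def\<close>)
  thus "of_nat (calls s) \<le> (of_nat (calls s') :: ennreal)"
    by simp
qed

lemma increasing_along_halted:
  "increasing_along (step A chi z) (indicator {s. halted s})"
  "increasing_along (step A chi z) (indicator {s. halted s \<and> P s})"
  by (auto simp: increasing_along_def step_def halted_def indicator_def)

lemma iter_exp_le_1:
  assumes "\<And>s. f s \<le> 1"
  shows "iter_exp K f n s \<le> 1"
proof (induction n arbitrary: s)
  case (Suc n)
  have "iter_exp K f (Suc n) s \<le> (\<integral>\<^sup>+ t. 1 \<partial>measure_pmf (K s))"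
    unfolding iter_exp.simps by (intro nn_integral_mono Suc.IH)
  thus ?case
    by simp
qed (simp add: assms)

lemma next_bound_bounds:
  assumes "0 \<le> m"
  shows "0 < next_bound m" "4 * next_bound m \<le> 5 * m + 4" "5 * m \<le> 4 * next_bound m"
  using assms by (auto simp: next_bound_def)

locale amplitude_search =
  fixes A :: "(int \<Rightarrow>\<^sub>0 'k::complex_inner) \<Rightarrow> (int \<Rightarrow>\<^sub>0 'k)"
    and chi :: "int \<Rightarrow> bool" and z :: "int \<Rightarrow>\<^sub>0 'k"
  assumes unitary: "is_unitary A" and unit: "cinner z z = 1"
begin

abbreviation K :: "(int \<Rightarrow>\<^sub>0 'k) config \<Rightarrow> (int \<Rightarrow>\<^sub>0 'k) config pmf" where
  "K \<equiv> step A chi z"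

abbreviation start :: "(nat \<Rightarrow> int) \<Rightarrow> int option \<Rightarrow> (int \<Rightarrow>\<^sub>0 'k) \<Rightarrow> nat \<Rightarrow> (int \<Rightarrow>\<^sub>0 'k) config" where
  "start \<equiv> round_config z"

abbreviation iterations :: "(nat \<Rightarrow> int) \<Rightarrow> nat pmf" where
  "iterations vs \<equiv> pmf_of_set {..<nat (next_bound (vs 0))}"

abbreviation outcome :: "nat \<Rightarrow> int pmf" where
  "outcome j \<equiv> outcome_pmf (grover_state A chi z j)"

abbreviation result :: "(nat \<Rightarrow> int) \<Rightarrow> nat \<Rightarrow> nat \<Rightarrow> int \<Rightarrow> (int \<Rightarrow>\<^sub>0 'k) config" where
  "result \<equiv> round_result A chi z"

abbreviation call_count :: "(int \<Rightarrow>\<^sub>0 'k) config \<Rightarrow> ennreal" where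
  "call_count \<equiv> \<lambda>s. of_nat (calls s)"

definition a :: real where
  "a = success_prob chi (A z)"

definition \<theta> :: real where
  "\<theta> = arcsin (sqrt a)"

definition p :: "nat \<Rightarrow> real" where
  "p j = (sin ((2 * real j + 1) * \<theta>))\<^sup>2"

lemma a_bounds: "0 \<le> a" "a \<le> 1" "0 \<le> sqrt a" "sqrt a \<le> 1"
  using success_prob_nonneg[of chi "A z"] success_prob_le_1[of "A z" chi] unitary unit
  by (simp_all add: a_def is_unitary_def)

lemma sin_theta: "sin \<theta> = sqrt a"
  unfolding \<theta>_def by (rule sin_arcsin) (use a_bounds(3,4) in linarith)+

lemma theta_bounds: "0 \<le> \<theta>" "\<theta> \<le> pi / 2"
proof -
  show "0 \<le> \<theta>"
    using a_bounds by (simp add: \<theta>_def arcsin_nonneg)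
  show "\<theta> \<le> pi / 2"
    unfolding \<theta>_def by (rule arcsin_ubound) (use a_bounds(3,4) in linarith)+
qed

lemma prob_good: "measure_pmf.prob (outcome j) {i. chi i} = p j"
  unfolding p_def
  by (rule prob_good_grover_state[OF unitary unit]) (simp add: sin_theta a_bounds a_def[symmetric])

lemma p_bounds: "0 \<le> p j" "p j \<le> 1"
  by (simp_all add: p_def abs_square_le_1)

lemma p_0: "p 0 = a"
  by (simp add: p_def sin_theta a_bounds)

text \<open>A round with \<open>j\<close> iterations makes \<open>2 * j + 1\<close> calls, so each
  call buys at most \<open>sqrt a\<close> of success probability.\<close>

lemma p_le: "p j \<le> sqrt a * (2 * real j + 1)"
proof -
  let ?s = "\<bar>sin ((2 * real j + 1) * \<theta>)\<bar>"
  have "p j = ?s * ?s"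
    by (simp add: p_def power2_eq_square)
  also have "\<dots> \<le> ?s * 1"
    by (rule mult_left_mono) auto
  also have "\<dots> \<le> (2 * real j + 1) * sqrt a"
    using abs_sin_odd_multiple_le[of j \<theta>] a_bounds by (simp add: sin_theta)
  finally show ?thesis
    by (simp add: mult.commute)
qed

section \<open>Success probability of a round with bound \<open>m\<close>\<close>

definition mean_p :: "nat \<Rightarrow> real" where
  "mean_p m = (\<Sum>j<m. p j) / real m"

text \<open>The hypothesis of \<open>quarter_le_mean_sin_squared\<close> solved for
  \<open>m\<close>.\<close>

definition critical_bound :: real where
  "critical_bound = 3 / 2 / sqrt a"

lemma mean_p_bounds: "0 \<le> mean_p m" "mean_p m \<le> 1"
proof -
  show "0 \<le> mean_p m"
    by (simp add: mean_p_def sum_nonneg p_bounds)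
  have "(\<Sum>j<m. p j) \<le> (\<Sum>j<m. 1)"
    by (rule sum_mono) (rule p_bounds)
  thus "mean_p m \<le> 1"
    by (cases "m = 0") (simp_all add: mean_p_def)
qed

lemma quarter_le_mean_p:
  assumes "0 < a" "critical_bound \<le> real m"
  shows "1 / 4 \<le> mean_p m"
proof -
  have m: "3 / 2 \<le> real m * sin \<theta>"
    using assms by (simp add: critical_bound_def sin_theta field_simps)
  moreover have "0 < \<theta>"
    using theta_bounds(1) assms sin_theta by (cases "\<theta> = 0") auto
  ultimately have "real m / 4 \<le> (\<Sum>j<m. p j)"
    unfolding p_def using theta_bounds by (intro quarter_le_mean_sin_squared)
  moreover have "0 < m"
    using m by (cases m) auto
  ultimately show ?thesis
    by (simp add: mean_p_def field_simps)
qed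

text \<open>A positive bound uniform in \<open>m\<close>: below the critical bound the draw
  \<open>j = 0\<close> alone contributes \<open>p 0 = a\<close> to the mean.\<close>

lemma mean_p_lower:
  assumes "0 < a" "0 < m"
  shows "min (1 / 4) (a / critical_bound) \<le> mean_p m"
proof (cases "critical_bound \<le> real m")
  case True
  thus ?thesis
    using quarter_le_mean_p[OF assms(1)] by (simp add: min_le_iff_disj)
next
  case False
  have "a \<le> (\<Sum>j<m. p j)"
    using member_le_sum[of 0 "{..<m}" p] assms p_bounds by (simp add: p_0)
  hence "a / real m \<le> mean_p m"
    using assms by (simp add: mean_p_def divide_right_mono)
  moreover have "a / critical_bound \<le> a / real m"
    using False assms by (intro divide_left_mono) auto
  ultimately show ?thesis
    by linarith
qed

text \<open>One genuine step lowers the index to \<open>n\<close>; the rest of the round, however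
  long, can only increase the subharmonic \<open>n\<close>-step iterate. This permits induction over
  \<open>n\<close> from round to round.\<close>

lemma round_upper:
  assumes "increasing_along K f" "0 \<le> vs 0"
  shows "iter_exp K f (Suc n) (start vs lo q c)
    \<le> (\<integral>\<^sup>+ j. (\<integral>\<^sup>+ i. iter_exp K f n (result vs c j i) \<partial>outcome j) \<partial>iterations vs)"
proof -
  obtain s where "K (start vs lo q c) = return_pmf s"
    "reaches K s (bind_pmf (iterations vs) (\<lambda>j. map_pmf (result vs c j) (outcome j)))"
    using round_config_reaches[where vs = vs and K = K, OF assms(2) refl] by blast
  thus ?thesis
    using subharmonic_iter_exp[OF assms(1), of n] by (auto simp: reaches_def)
qed

lemma round_lower:
  assumes "increasing_along K f" "0 \<le> vs 0"
  shows "(\<integral>\<^sup>+ j. (\<integral>\<^sup>+ i. limit_exp K f (result vs c j i) \<partial>outcome j) \<partial>iterations vs)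
    \<le> limit_exp K f (start vs lo q c)"
proof -
  obtain s where "K (start vs lo q c) = return_pmf s"
    "reaches K s (bind_pmf (iterations vs) (\<lambda>j. map_pmf (result vs c j) (outcome j)))"
    using round_config_reaches[where vs = vs and K = K, OF assms(2) refl] by blast
  hence "reaches K (start vs lo q c)
      (bind_pmf (iterations vs) (\<lambda>j. map_pmf (result vs c j) (outcome j)))"
    by (rule reaches_step_return)
  thus ?thesis
    using superharmonic_limit_exp[OF assms(1)] by (auto simp: reaches_def)
qed

section \<open>Upper bound on the expected number of calls\<close>

lemma iter_exp_halt_config: "iter_exp K f n (halt_config vs lo q c) = f (halt_config vs lo q c)"
  by (rule iter_exp_absorbing) (simp add: step_def halt_config_def)

text \<open>The odd numbers \<open>2 * j + 1\<close> average to \<open>m\<close>, the expected calls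
  of a round; \<open>v\<close> stands for the cost after a failure.\<close>

lemma mean_affine:
  assumes "0 < m"
  shows "(\<Sum>j<m. x + 2 * real j + 1 + (1 - p j) * v) / real m
    = x + real m + (1 - mean_p m) * v"
proof -
  have "(\<Sum>j<m. x + 2 * real j + 1 + (1 - p j) * v)
      = (\<Sum>j<m. x + v) + (\<Sum>j<m. 2 * real j + 1) - (\<Sum>j<m. p j) * v"
    unfolding sum_distrib_right sum.distrib[symmetric] sum_subtractf[symmetric]
    by (rule sum.cong) (auto simp: algebra_simps)
  also have "\<dots> = real m * (x + v) + (real m)\<^sup>2 - (\<Sum>j<m. p j) * v"
    by (simp add: sum_odd_numbers)
  finally show ?thesis
    using assms by (simp add: mean_p_def field_simps power2_eq_square)
qed

text \<open>
  Expected number of calls still to be made from bound \<open>m\<close>: the slope \<open>-5\<close> below the critical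
  bound pays for rounds that may all fail, while beyond it a bound growing by \<open>5/4\<close> and a failure
  probability of at most \<open>3/4\<close> give a convergent geometric series.
\<close>

definition potential :: "int \<Rightarrow> real" where
  "potential m = 20 * of_int m + 64 + 25 * max 0 (critical_bound - of_int m)"

lemma potential_nonneg: "0 \<le> m \<Longrightarrow> 0 \<le> potential m"
  by (simp add: potential_def)

lemma potential_step:
  assumes a: "0 < a" and m: "0 \<le> m"
  defines "m' \<equiv> next_bound m"
  shows "of_int m' + (1 - mean_p (nat m')) * potential m' \<le> potential m"
proof -
  have m': "0 < m'" "4 * real_of_int m' \<le> 5 * of_int m + 4" "5 * of_int m \<le> 4 * real_of_int m'"
    using next_bound_bounds[OF m] unfolding m'_def by linarith+
  have nn: "0 \<le> potential m'"
    using m' by (simp add: potential_nonneg)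
  show ?thesis
  proof (cases "critical_bound \<le> of_int m'")
    case True
    \<comment> \<open>The left side is at most \<open>16 * m' + 48\<close>, and
      \<open>4 * m' \<le> 5 * m + 4\<close> bounds this by exactly
      \<open>20 * m + 64\<close>.\<close>
    hence "1 - mean_p (nat m') \<le> 3 / 4"
      using quarter_le_mean_p[OF a, of "nat m'"] m' by simp
    hence "(1 - mean_p (nat m')) * potential m' \<le> 3 / 4 * potential m'"
      using nn by (rule mult_right_mono)
    moreover have "potential m' = 20 * of_int m' + 64" "20 * of_int m + 64 \<le> potential m"
      using True by (simp_all add: potential_def)
    ultimately show ?thesis
      using m' by linarith
  next
    case False
    \<comment> \<open>Failure is bounded by 1. Adding the \<open>m'\<close> calls leaves slope -4 in
      \<open>m'\<close>, and \<open>4 * m' \<ge> 5 * m\<close>.\<close>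
    have "(1 - mean_p (nat m')) * potential m' \<le> 1 * potential m'"
      using nn mean_p_bounds by (intro mult_right_mono) auto
    moreover have "potential m' = 64 + 25 * critical_bound - 5 * of_int m'"
      "64 + 25 * critical_bound - 5 * of_int m \<le> potential m"
      using False by (simp_all add: potential_def max_def)
    ultimately show ?thesis
      using m' by linarith
  qed
qed

text \<open>Induction over the steps, generalised over round starts: a failed round leads to another
  start, and \<open>potential_step\<close> closes the recursion.\<close>

lemma iter_calls_le:
  assumes "0 < a" "0 \<le> vs 0"
  shows "iter_exp K call_count n (start vs lo q c) \<le> ennreal (real c + potential (vs 0))"
  using assms(2)
proof (induction n arbitrary: vs lo q c)
  case 0
  have "ennreal (real c) \<le> ennreal (real c + potential (vs 0))"
    using potential_nonneg[OF 0] by (intro ennreal_leI) simp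
  thus ?case
    by (simp add: round_config_def ennreal_of_nat_eq_real_of_nat)
next
  case (Suc n)
  define m where "m = nat (next_bound (vs 0))"
  define v where "v = potential (next_bound (vs 0))"
  have m: "0 < m" "next_bound (vs 0) = int m"
    using next_bound_bounds[OF Suc.prems] by (simp_all add: m_def)
  have v: "0 \<le> v"
    unfolding v_def m by (rule potential_nonneg) simp
  define vs' where "vs' = vs(0 := next_bound (vs 0), 1 := 0)"
  have vs': "vs' 0 = next_bound (vs 0)" "0 \<le> vs' 0"
    using m by (simp_all add: vs'_def)
  have calls_eq: "real (c + 2 * j + 1) = real c + 2 * real j + 1" for j
    by simp
  have pt: "iter_exp K call_count n (result vs c j i)
      \<le> (if chi i then ennreal (real c + 2 * real j + 1)
         else ennreal (real c + 2 * real j + 1 + v))" for i j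
  proof (cases "chi i")
    case True
    hence "iter_exp K call_count n (result vs c j i) = of_nat (c + 2 * j + 1)"
      unfolding round_result_def by (simp add: iter_exp_halt_config) (simp add: halt_config_def)
    also have "\<dots> = ennreal (real c + 2 * real j + 1)"
      using calls_eq[of j] by (simp only: ennreal_of_nat_eq_real_of_nat)
    finally show ?thesis
      using True by simp
  next
    case False
    hence "iter_exp K call_count n (result vs c j i)
        \<le> ennreal (real (c + 2 * j + 1) + potential (vs' 0))"
      unfolding round_result_def vs'_def[symmetric] by (simp only: if_False) (rule Suc.IH[where vs = vs', OF vs'(2)])
    thus ?thesis
      using False unfolding calls_eq by (simp only: if_False v_def vs')
  qed
  have "iter_exp K call_count (Suc n) (start vs lo q c)
      \<le> (\<integral>\<^sup>+ j. (\<integral>\<^sup>+ i. iter_exp K call_count n (result vs c j i) \<partial>outcome j) \<partial>iterations vs)"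
    by (rule round_upper[where vs = vs, OF increasing_along_calls Suc.prems])
  also have "\<dots> \<le> (\<integral>\<^sup>+ j. (\<integral>\<^sup>+ i. (if chi i then ennreal (real c + 2 * real j + 1)
         else ennreal (real c + 2 * real j + 1 + v)) \<partial>outcome j) \<partial>iterations vs)"
    by (intro nn_integral_mono pt)
  also have "\<dots> = (\<integral>\<^sup>+ j. ennreal (real c + 2 * real j + 1 + (1 - p j) * v) \<partial>iterations vs)"
    using v by (subst nn_integral_pmf_if) (simp_all add: prob_good algebra_simps)
  also have "\<dots> = ennreal ((\<Sum>j<m. real c + 2 * real j + 1 + (1 - p j) * v) / real m)"
    unfolding m_def[symmetric] using m v p_bounds by (intro nn_integral_lessThan) auto
  also have "\<dots> = ennreal (real c + (real m + (1 - mean_p m) * v))"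
    using mean_affine[OF m(1), of "real c" v] by (simp add: add.assoc)
  also have "\<dots> \<le> ennreal (real c + potential (vs 0))"
    using potential_step[OF assms(1) Suc.prems] unfolding m(2) v_def
    by (intro ennreal_leI add_left_mono) simp
  finally show ?case .
qed

text \<open>
  This covers \<open>a = 0\<close> as well: the right-hand side is then 0, since \<open>0 * \<infinity> = 0\<close> in \<open>ennreal\<close>.
\<close>

lemma iter_halted_le:
  assumes "0 \<le> vs 0"
  shows "iter_exp K (indicator {s. halted s}) n (start vs lo q c) + ennreal (sqrt a * real c)
    \<le> ennreal (sqrt a) * limit_exp K call_count (start vs lo q c)"
  using assms
proof (induction n arbitrary: vs lo q c)
  case 0
  have "ennreal (sqrt a * real c) = ennreal (sqrt a) * ennreal (real c)"
    by (rule ennreal_mult) (simp_all add: a_bounds)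
  also have "ennreal (real c) = call_count (start vs lo q c)"
    by (simp add: round_config_def ennreal_of_nat_eq_real_of_nat)
  also have "ennreal (sqrt a) * call_count (start vs lo q c)
      \<le> ennreal (sqrt a) * limit_exp K call_count (start vs lo q c)"
    by (intro mult_left_mono le_limit_exp[of call_count]) simp
  finally show ?case
    by (simp add: round_config_def halted_def)
next
  case (Suc n)
  let ?h = "indicator {s. halted s}"
  let ?E = "limit_exp K call_count"
  \<comment> \<open>On success the halting probability is not yet paid for by calls; the indicator
    records this debt.\<close>
  have pt: "iter_exp K ?h n (result vs c j i) + ennreal (sqrt a * (real c + (2 * real j + 1)))
      \<le> ennreal (sqrt a) * ?E (result vs c j i) + indicator {i. chi i} i" for i j
  proof (cases "chi i")
    case True
    have "ennreal (sqrt a) * call_count (result vs c j i) \<le> ennreal (sqrt a) * ?E (result vs c j i)"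
      by (intro mult_left_mono le_limit_exp[of call_count]) simp
    moreover have "call_count (result vs c j i) = ennreal (real c + (2 * real j + 1))"
      using True by (simp add: round_result_def halt_config_def ennreal_of_nat_eq_real_of_nat add_ac)
    ultimately have "ennreal (sqrt a * (real c + (2 * real j + 1)))
        \<le> ennreal (sqrt a) * ?E (result vs c j i)"
      using a_bounds by (simp add: ennreal_mult)
    moreover have "iter_exp K ?h n (result vs c j i) \<le> 1"
      by (rule iter_exp_le_1) (simp add: indicator_def)
    ultimately show ?thesis
      using True by (simp add: add_mono add.commute)
  next
    case False
    define vs' where "vs' = vs(0 := next_bound (vs 0), 1 := 0)"
    have "0 \<le> vs' 0"
      using next_bound_bounds(1)[OF Suc.prems] by (simp add: vs'_def)
    hence "iter_exp K ?h n (result vs c j i) + ennreal (sqrt a * real (c + 2 * j + 1))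
        \<le> ennreal (sqrt a) * ?E (result vs c j i)"
      using False unfolding round_result_def vs'_def[symmetric]
      by (simp only: if_False) (rule Suc.IH)
    moreover have "real (c + 2 * j + 1) = real c + (2 * real j + 1)"
      by simp
    ultimately show ?thesis
      using False by (simp only: indicator_simps mem_Collect_eq add_0_right not_False_eq_True)
  qed
  have step: "(\<integral>\<^sup>+ i. iter_exp K ?h n (result vs c j i) \<partial>outcome j) + ennreal (sqrt a * real c)
      \<le> ennreal (sqrt a) * (\<integral>\<^sup>+ i. ?E (result vs c j i) \<partial>outcome j)" for j
  proof -
    let ?d = "ennreal (sqrt a * (2 * real j + 1))"
    have "(\<integral>\<^sup>+ i. iter_exp K ?h n (result vs c j i) + ennreal (sqrt a * (real c + (2 * real j + 1)))
          \<partial>outcome j)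
        \<le> (\<integral>\<^sup>+ i. ennreal (sqrt a) * ?E (result vs c j i) + indicator {i. chi i} i \<partial>outcome j)"
      by (intro nn_integral_mono pt)
    hence "(\<integral>\<^sup>+ i. iter_exp K ?h n (result vs c j i) \<partial>outcome j)
          + ennreal (sqrt a * (real c + (2 * real j + 1)))
        \<le> ennreal (sqrt a) * (\<integral>\<^sup>+ i. ?E (result vs c j i) \<partial>outcome j) + ennreal (p j)"
      by (simp add: nn_integral_add nn_integral_cmult measure_pmf.emeasure_eq_measure prob_good)
    \<comment> \<open>Averaged over outcomes the debt is \<open>p j\<close>, which the calls of this
      round cover by \<open>p_le\<close>.\<close>
    also have "\<dots> \<le> ennreal (sqrt a) * (\<integral>\<^sup>+ i. ?E (result vs c j i) \<partial>outcome j) + ?d"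
      by (intro add_left_mono ennreal_leI p_le)
    also have "ennreal (sqrt a * (real c + (2 * real j + 1))) = ennreal (sqrt a * real c) + ?d"
      using a_bounds by (simp add: distrib_left ennreal_plus[symmetric] del: ennreal_plus)
    \<comment> \<open>The finite summand \<open>?d\<close> cancels on both sides.\<close>
    finally show ?thesis
      by (simp add: add.assoc[symmetric])
  qed
  have "iter_exp K ?h (Suc n) (start vs lo q c) + ennreal (sqrt a * real c)
      \<le> (\<integral>\<^sup>+ j. (\<integral>\<^sup>+ i. iter_exp K ?h n (result vs c j i) \<partial>outcome j) \<partial>iterations vs)
        + ennreal (sqrt a * real c)"
    by (intro add_right_mono round_upper increasing_along_halted(1) Suc.prems)
  also have "\<dots> = (\<integral>\<^sup>+ j. (\<integral>\<^sup>+ i. iter_exp K ?h n (result vs c j i) \<partial>outcome j)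
        + ennreal (sqrt a * real c) \<partial>iterations vs)"
    by (simp add: nn_integral_add)
  also have "\<dots> \<le> (\<integral>\<^sup>+ j. ennreal (sqrt a) * (\<integral>\<^sup>+ i. ?E (result vs c j i) \<partial>outcome j) \<partial>iterations vs)"
    by (intro nn_integral_mono step)
  also have "\<dots> = ennreal (sqrt a)
      * (\<integral>\<^sup>+ j. (\<integral>\<^sup>+ i. ?E (result vs c j i) \<partial>outcome j) \<partial>iterations vs)"
    by (simp add: nn_integral_cmult)
  also have "\<dots> \<le> ennreal (sqrt a) * ?E (start vs lo q c)"
    by (intro mult_left_mono round_lower increasing_along_calls Suc.prems) simp
  finally show ?case .
qed

abbreviation good_config :: "(int \<Rightarrow>\<^sub>0 'k) config \<Rightarrow> bool" where
  "good_config s \<equiv> halted s \<and> (\<exists>i. last_outcome s = Some i \<and> chi i)"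

text \<open>
  The infimum \<open>r\<close> of the success probability over all configurations at the start of a round
  satisfies \<open>\<epsilon> + (1 - \<epsilon>) * r \<le> r\<close>, which forces \<open>r = 1\<close>.
\<close>

lemma limit_good_start:
  assumes "0 < a" "0 \<le> vs 0"
  shows "limit_exp K (indicator {s. good_config s}) (start vs lo q c) = 1"
proof -
  let ?S = "limit_exp K (indicator {s. good_config s})"
  let ?R = "{start vs lo q c | vs lo q c. 0 \<le> vs 0}"
  define \<epsilon> where "\<epsilon> = min (1 / 4) (a / critical_bound)"
  have \<epsilon>: "0 < \<epsilon>"
    using assms by (simp add: \<epsilon>_def critical_bound_def)
  have S_le: "?S s \<le> 1" for s
    unfolding limit_exp_def by (intro SUP_least iter_exp_le_1) (simp add: indicator_def)
  have R: "start vs lo q c \<in> ?R"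
    using assms(2) by blast
  have "(INF s\<in>?R. ?S s) \<le> 1"
    using INF_lower[OF R, of ?S] S_le by (rule order_trans)
  then obtain r where r: "(INF s\<in>?R. ?S s) = ennreal r" "0 \<le> r" "r \<le> 1"
    by (cases "INF s\<in>?R. ?S s") (auto simp: top_unique)
  have "ennreal (\<epsilon> + (1 - \<epsilon>) * r) \<le> ?S s" if s_R: "s \<in> ?R" for s
  proof -
    obtain vs lo q c where s: "s = start vs lo q c" and vs: "0 \<le> vs 0"
      using s_R by blast
    define m where "m = nat (next_bound (vs 0))"
    have m: "0 < m"
      using next_bound_bounds(1)[OF vs] by (simp add: m_def)
    have pt: "(if chi i then ennreal 1 else ennreal r) \<le> ?S (result vs c j i)" for i j
    proof (cases "chi i")
      case True
      have "indicator {s. good_config s} (result vs c j i) \<le> ?S (result vs c j i)"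
        by (rule le_limit_exp)
      thus ?thesis
        using True by (simp add: round_result_def halt_config_def halted_def)
    next
      case False
      have "result vs c j i \<in> ?R"
        using False next_bound_bounds(1)[OF vs] unfolding round_result_def by force
      hence "(INF s\<in>?R. ?S s) \<le> ?S (result vs c j i)"
        by (rule INF_lower)
      thus ?thesis
        using False r(1) by simp
    qed
    \<comment> \<open>As \<open>1 - r\<close> is nonnegative, the expression increases with the
      success probability of the round, which is at least \<epsilon>.\<close>
    have "\<epsilon> + (1 - \<epsilon>) * r \<le> mean_p m + (1 - mean_p m) * r"
    proof -
      have "\<epsilon> * (1 - r) \<le> mean_p m * (1 - r)"
        unfolding \<epsilon>_def using r by (intro mult_right_mono mean_p_lower assms m) simp
      thus ?thesis
        by (simp add: algebra_simps)
    qed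
    also have "\<dots> = (\<Sum>j<m. p j * 1 + (1 - p j) * r) / real m"
      using m
      by (simp add: mean_p_def sum.distrib sum_subtractf sum_distrib_right[symmetric]
          left_diff_distrib) (simp add: field_simps)
    finally have "ennreal (\<epsilon> + (1 - \<epsilon>) * r)
        \<le> ennreal ((\<Sum>j<m. p j * 1 + (1 - p j) * r) / real m)"
      by (rule ennreal_leI)
    also have "\<dots> = (\<integral>\<^sup>+ j. ennreal (p j * 1 + (1 - p j) * r) \<partial>iterations vs)"
      unfolding m_def[symmetric] using m r p_bounds by (intro nn_integral_lessThan[symmetric]) auto
    also have "\<dots> = (\<integral>\<^sup>+ j. (\<integral>\<^sup>+ i. (if chi i then ennreal 1 else ennreal r) \<partial>outcome j)
        \<partial>iterations vs)"
      using r by (subst nn_integral_pmf_if) (simp_all add: prob_good)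
    also have "\<dots> \<le> (\<integral>\<^sup>+ j. (\<integral>\<^sup>+ i. ?S (result vs c j i) \<partial>outcome j) \<partial>iterations vs)"
      by (intro nn_integral_mono pt)
    also have "\<dots> \<le> ?S s"
      unfolding s by (intro round_lower increasing_along_halted(2) vs)
    finally show ?thesis .
  qed
  \<comment> \<open>The bound holds at every round start, so it passes to the infimum.\<close>
  hence "ennreal (\<epsilon> + (1 - \<epsilon>) * r) \<le> ennreal r"
    unfolding r(1)[symmetric] by (rule INF_greatest)
  hence "\<epsilon> * (1 - r) \<le> 0"
    using r by (simp add: algebra_simps)
  hence "r = 1"
    using \<epsilon> r by (simp add: mult_le_0_iff)
  hence "1 \<le> ?S (start vs lo q c)"
    using INF_lower[OF R, of ?S] r(1) by simp
  thus ?thesis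
    using S_le by (rule antisym[rotated])
qed

section \<open>From rounds to the whole program\<close>

abbreviation init :: "(int \<Rightarrow>\<^sub>0 'k) config" where
  "init \<equiv> init_config z (search_alg z)"

lemma step_init: "K init = return_pmf (start (\<lambda>_. 0) None z 0)"
  by (simp add: step_def init_config_def search_alg_def round_config_def)

text \<open>One deterministic step in front does not change the limit: monotonicity in
  \<open>n\<close> gives one direction, superharmonicity the other.\<close>

lemma limit_exp_init:
  assumes "increasing_along K f"
  shows "limit_exp K f init = limit_exp K f (start (\<lambda>_. 0) None z 0)"
proof (rule antisym)
  show "limit_exp K f init \<le> limit_exp K f (start (\<lambda>_. 0) None z 0)"
    unfolding limit_exp_def[of K f init]
  proof (rule SUP_least)
    fix n
    have "iter_exp K f n init \<le> iter_exp K f (Suc n) init"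
      by (rule iter_exp_le_Suc[OF assms])
    also have "\<dots> = iter_exp K f n (start (\<lambda>_. 0) None z 0)"
      by (simp add: step_init)
    also have "\<dots> \<le> limit_exp K f (start (\<lambda>_. 0) None z 0)"
      by (rule iter_exp_le_limit_exp)
    finally show "iter_exp K f n init \<le> limit_exp K f (start (\<lambda>_. 0) None z 0)" .
  qed
  show "limit_exp K f (start (\<lambda>_. 0) None z 0) \<le> limit_exp K f init"
  proof -
    have "(\<integral>\<^sup>+ s. limit_exp K f s \<partial>measure_pmf (K init)) \<le> limit_exp K f init"
      using superharmonic_limit_exp[OF assms] unfolding superharmonic_def ..
    thus ?thesis
      unfolding step_init by simp
  qed
qed

text \<open>Probabilities are at most 1, so the real supremum is a genuine one and agrees with that
  in \<open>ennreal\<close>.\<close>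

lemma SUP_prob_run:
  "ennreal (SUP n. measure_pmf.prob (run A chi z (search_alg z) n) X)
    = limit_exp K (indicator X) init"
proof -
  have "limit_exp K (indicator X) init
      = (SUP n. ennreal (measure_pmf.prob (run A chi z (search_alg z) n) X))"
    unfolding limit_exp_def nn_integral_run[symmetric]
    by (simp add: measure_pmf.emeasure_eq_measure)
  moreover have "\<dots> \<le> 1"
    by (intro SUP_least) simp
  hence "(SUP n. ennreal (measure_pmf.prob (run A chi z (search_alg z) n) X)) \<noteq> \<top>"
    by (rule neq_top_trans[OF ennreal_one_neq_top])
  ultimately show ?thesis
    by (subst ennreal_SUP) simp_all
qed

lemma expected_calls_eq:
  "expected_calls A chi z (search_alg z) = limit_exp K call_count (start (\<lambda>_. 0) None z 0)"
  unfolding expected_calls_def nn_integral_run limit_exp_def[symmetric]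
  by (rule limit_exp_init[OF increasing_along_calls])

text \<open>The case \<open>c = 0\<close> of \<open>iter_halted_le\<close>. It yields the lower
  bound on the calls for positive \<open>a\<close> and non-termination for
  \<open>a = 0\<close>.\<close>

lemma halting_prob_le:
  "ennreal (halting_prob A chi z (search_alg z))
    \<le> ennreal (sqrt a) * expected_calls A chi z (search_alg z)"
proof -
  have "ennreal (halting_prob A chi z (search_alg z))
      = limit_exp K (indicator {s. halted s}) (start (\<lambda>_. 0) None z 0)"
    unfolding halting_prob_def SUP_prob_run by (rule limit_exp_init[OF increasing_along_halted(1)])
  also have "\<dots> \<le> ennreal (sqrt a) * limit_exp K call_count (start (\<lambda>_. 0) None z 0)"
    unfolding limit_exp_def[of K "indicator _"]
    by (rule SUP_least) (use iter_halted_le[of "\<lambda>_. 0" _ None z 0] in simp)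
  finally show ?thesis
    unfolding expected_calls_eq .
qed

lemma finds_good_prob_eq_1:
  assumes "0 < a"
  shows "finds_good_prob A chi z (search_alg z) = 1"
proof -
  have "ennreal (finds_good_prob A chi z (search_alg z)) = ennreal 1"
    unfolding finds_good_prob_def SUP_prob_run
    using limit_good_start[OF assms, of "\<lambda>_. 0"] limit_exp_init[OF increasing_along_halted(2)] by simp
  thus ?thesis
    by (simp only: ennreal_eq_1 ennreal_1)
qed

lemma finds_good_prob_le_halting_prob:
  "finds_good_prob A chi z (search_alg z) \<le> halting_prob A chi z (search_alg z)"
  unfolding finds_good_prob_def halting_prob_def
proof (rule cSUP_mono)
  show "bdd_above (range (\<lambda>n. measure_pmf.prob (run A chi z (search_alg z) n) {s. halted s}))"
    by (rule bdd_aboveI[of _ 1]) auto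
  show "\<exists>m\<in>UNIV. measure_pmf.prob (run A chi z (search_alg z) n) {s. good_config s}
      \<le> measure_pmf.prob (run A chi z (search_alg z) m) {s. halted s}" for n
    by (intro bexI[of _ n] measure_pmf.finite_measure_mono) auto
qed simp

lemma expected_calls_ge:
  assumes "0 < a"
  shows "ennreal (1 * sqrt (1 / a)) \<le> expected_calls A chi z (search_alg z)"
proof -
  let ?E = "expected_calls A chi z (search_alg z)"
  have "1 \<le> ennreal (halting_prob A chi z (search_alg z))"
    using finds_good_prob_le_halting_prob finds_good_prob_eq_1[OF assms] by simp
  hence "1 \<le> ennreal (sqrt a) * ?E"
    using halting_prob_le by (rule order_trans)
  hence "ennreal (1 / sqrt a) * 1 \<le> ennreal (1 / sqrt a) * (ennreal (sqrt a) * ?E)"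
    by (intro mult_left_mono) auto
  also have "\<dots> = ennreal (1 / sqrt a * sqrt a) * ?E"
    using assms
    by (simp only: ennreal_mult mult.assoc zero_le_divide_1_iff real_sqrt_ge_zero less_imp_le)
  finally show ?thesis
    using assms by (simp add: real_sqrt_divide)
qed

lemma expected_calls_le:
  assumes "0 < a"
  shows "expected_calls A chi z (search_alg z) \<le> ennreal (102 * sqrt (1 / a))"
proof -
  have "expected_calls A chi z (search_alg z) \<le> ennreal (0 + potential 0)"
    unfolding expected_calls_eq limit_exp_def
    by (rule SUP_least) (use iter_calls_le[OF assms, of "\<lambda>_. 0" _ None z 0] in simp)
  \<comment> \<open>\<open>potential 0\<close> is \<open>64 + 37.5 * sqrt (1 / a)\<close>; as
    \<open>sqrt (1 / a)\<close> is at least 1, the factor 101.5 suffices, here rounded up.\<close>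
  also have "0 + potential 0 \<le> 102 * sqrt (1 / a)"
  proof -
    have "1 \<le> sqrt (1 / a)"
      using assms a_bounds by simp
    moreover have "critical_bound = 3 / 2 * sqrt (1 / a)"
      by (simp add: critical_bound_def real_sqrt_divide)
    moreover have "potential 0 = 64 + 25 * critical_bound"
      using assms by (simp add: potential_def critical_bound_def)
    ultimately show ?thesis
      by linarith
  qed
  finally show ?thesis
    by (simp add: ennreal_leI)
qed

lemma halting_prob_eq_0:
  assumes "a = 0"
  shows "halting_prob A chi z (search_alg z) = 0"
proof -
  have "halting_prob A chi z (search_alg z) \<le> 0"
    using halting_prob_le by (simp add: assms ennreal_eq_0_iff)
  moreover have "0 \<le> finds_good_prob A chi z (search_alg z)"
    unfolding finds_good_prob_def
    by (rule cSUP_upper2[of _ _ 0]) (auto intro!: bdd_aboveI[of _ 1])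
  ultimately show ?thesis
    using finds_good_prob_le_halting_prob by simp
qed

end

theorem theorem3:
  fixes z :: "'k::complex_inner"
  assumes "cinner z z = 1"
  shows "\<exists>(alg :: (int \<Rightarrow>\<^sub>0 'k) com) (c1::real) (c2::real).
    unitary_gates alg \<and> 0 < c1 \<and> 0 < c2 \<and>
    (\<forall>(A :: (int \<Rightarrow>\<^sub>0 'k) \<Rightarrow> (int \<Rightarrow>\<^sub>0 'k)) (chi :: int \<Rightarrow> bool). is_unitary A \<longrightarrow>
      (let a = success_prob chi (A (ket 0 z)) in
        (if a > 0 then
           finds_good_prob A chi (ket 0 z) alg = 1 \<and>
           ennreal (c1 * sqrt (1 / a)) \<le> expected_calls A chi (ket 0 z) alg \<and>
           expected_calls A chi (ket 0 z) alg \<le> ennreal (c2 * sqrt (1 / a))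
         else halting_prob A chi (ket 0 z) alg = 0)))"
proof (intro exI conjI allI impI)
  \<comment> \<open>The program is built from the initial state alone, before \<open>A\<close> and
    \<open>chi\<close> are chosen.\<close>
  let ?z = "ket 0 z" and ?alg = "search_alg (ket 0 z)"
  have unit: "cinner ?z ?z = 1"
    using assms by (subst cinner_poly_mapping_superset[of "{0}"]) auto
  show "unitary_gates ?alg"
    by (rule unitary_gates_search_alg[OF unit])
  show "0 < (1::real)" "0 < (102::real)"
    by simp_all
  fix A :: "(int \<Rightarrow>\<^sub>0 'k) \<Rightarrow> (int \<Rightarrow>\<^sub>0 'k)" and chi :: "int \<Rightarrow> bool"
  assume "is_unitary A"
  then interpret amplitude_search A chi ?z
    using unit by unfold_locales
  show "let a = success_prob chi (A ?z) in
      if a > 0 then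
        finds_good_prob A chi ?z ?alg = 1 \<and>
        ennreal (1 * sqrt (1 / a)) \<le> expected_calls A chi ?z ?alg \<and>
        expected_calls A chi ?z ?alg \<le> ennreal (102 * sqrt (1 / a))
      else halting_prob A chi ?z ?alg = 0"
    unfolding Let_def a_def[symmetric]
    using a_bounds(1) finds_good_prob_eq_1 expected_calls_ge expected_calls_le halting_prob_eq_0
    by (cases "0 < a") auto
qed

end
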